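(* Let $k,c>0$ and let $f,g\in\mathcal{D}'(\mathbb{R})$ be distributions. A solution $v\in\mathcal{C}^1(\mathbb{R},\mathcal{D}'(\mathbb{R}))$, in the sense of distributions, to the initial value problem $$v_{tt}=c^2v_{xx}+\tfrac{k^2}{4}v,\qquad v(0)=f,\qquad v_t(0)=g+\tfrac{k}{2}f$$ is given by $$\langle v(t),\varphi\rangle:=\left\langle f,\psi_t(t)\ast\varphi\right\rangle+\left\langle g+\tfrac{k}{2}f,\psi(t)\ast\varphi\right\rangle,\qquad \varphi\in\mathcal{C}_0^\infty(\mathbb{R}),\ t\in\mathbb{R}.$$
   Context: Let $\alpha=\frac{k}{4c}$ and $$\psi(x,t)=\operatorname{sgn}(t)\,\frac{1}{2c}\,I_0\!\left(2\alpha\sqrt{c^2t^2-x^2}\right)\mathcal{X}_{[-c|t|,c|t|]}(x),$$ $$\psi_t(\cdot,t)=\frac12\left[\delta(\cdot-ct)+\delta(\cdot+ct)\right]+\alpha c|t|\,\frac{I_0'\!\left(2\alpha\sqrt{c^2t^2-\cdot^2}\right)}{\sqrt{c^2t^2-\cdot^2}}\,\mathcal{X}_{[-c|t|,c|t|]}(\cdot),$$ where $I_0$ is the modified Bessel function of the first kind of order $0$, $\mathcal{X}_\Omega$ is the characteristic function of $\Omega$, $\delta(\cdot-a)$ is the Dirac delta at $x=a$, $\psi(\cdot,0)=0$, and $I_0'(2\alpha z)/z$ is understood by its limit $\alpha$ at $z=0$. We write $\psi(t)=\psi(\cdot,t)$, $\psi_t(t)=\psi_t(\cdot,t)$; both are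 compactly supported distributions in $x$, and $\ast$ is convolution in $x$, so $\psi(t)\ast\varphi,\psi_t(t)\ast\varphi\in\mathcal{C}_0^\infty(\mathbb{R})$. $\mathcal{C}^1(\mathbb{R},\mathcal{D}'(\mathbb{R}))$ is the space of maps $t\mapsto v(t)\in\mathcal{D}'(\mathbb{R})$ for which there is a map $t\mapsto v_t(t)\in\mathcal{D}'(\mathbb{R})$ such that, for every $\varphi\in\mathcal{C}_0^\infty(\mathbb{R})$ and $t\in\mathbb{R}$, $\left\langle \frac{v(t+h)-v(t)}{h},\varphi\right\rangle\to\langle v_t(t),\varphi\rangle$ and $\langle v_t(t+h),\varphi\rangle\to\langle v_t(t),\varphi\rangle$ as $h\to0$. A $v\in\mathcal{C}^1(\mathbb{R},\mathcal{D}'(\mathbb{R}))$ solves the equation in the sense of distributions if it holds in $\mathcal{D}'(\mathbb{R}\times\mathbb{R})$, i.e. $\int_{\mathbb{R}}\left\langle v(t),\left(\phi_{tt}-c^2\phi_{xx}-\frac{k^2}{4}\phi\right)(\cdot,t)\right\rangle dt=0$ for all $\phi\in\mathcal{C}_0^\infty(\mathbb{R}^2)$. The initial conditions are equalities in $\mathcal{D}'(\mathbb{R})$ at $t=0$. *)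

theory Defs
  imports "HOL-Analysis.Analysis"
begin

text \<open>Iterated partial derivatives: \<open>partial_derivs [b\<^sub>1, \<dots>, b\<^sub>n] \<phi>\<close> is
  \<open>\<partial>\<^sub>b\<^sub>1 \<dots> \<partial>\<^sub>b\<^sub>n \<phi>\<close>. On \<open>real\<close> the only
  basis vector is \<open>1\<close>, so this is the \<open>n\<close>-th derivative.\<close>

definition dir_deriv ::
    "'a::euclidean_space \<Rightarrow> ('a \<Rightarrow> complex) \<Rightarrow> 'a \<Rightarrow> complex" where
  "dir_deriv b \<phi> x = frechet_derivative \<phi> (at x) b"

definition partial_derivs ::
    "'a::euclidean_space list \<Rightarrow> ('a \<Rightarrow> complex) \<Rightarrow> 'a \<Rightarrow> complex" where
  "partial_derivs bs \<phi> = foldr dir_deriv bs \<phi>"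

definition smooth :: "('a::euclidean_space \<Rightarrow> complex) \<Rightarrow> bool" where
  "smooth \<phi> \<longleftrightarrow> (\<forall>bs \<in> lists Basis. \<forall>x. partial_derivs bs \<phi> differentiable (at x))"

definition supp :: "('a::euclidean_space \<Rightarrow> complex) \<Rightarrow> 'a set" where
  "supp \<phi> = closure (support_on UNIV \<phi>)"

definition test_functions :: "('a::euclidean_space \<Rightarrow> complex) set" where
  "test_functions = {\<phi>. smooth \<phi> \<and> compact (supp \<phi>)}"

definition test_seminorm :: "nat \<Rightarrow> ('a::euclidean_space \<Rightarrow> complex) \<Rightarrow> real" where
  "test_seminorm N \<phi> =
     (\<Sum>bs | set bs \<subseteq> Basis \<and> length bs \<le> N. SUP x. norm (partial_derivs bs \<phi> x))"

text \<open>A distribution is a linear functional on test functions which, on the test functions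
  supported in any fixed compact set, is bounded by a multiple of some \<open>test_seminorm\<close>.
  Functionals are total in HOL; their values outside \<open>test_functions\<close> are irrelevant, and
  equality of distributions is equality on \<open>test_functions\<close>.\<close>

definition distribution :: "(('a::euclidean_space \<Rightarrow> complex) \<Rightarrow> complex) \<Rightarrow> bool" where
  "distribution u \<longleftrightarrow>
     (\<forall>\<phi>\<in>test_functions. \<forall>\<eta>\<in>test_functions. u (\<lambda>x. \<phi> x + \<eta> x) = u \<phi> + u \<eta>) \<and>
     (\<forall>a. \<forall>\<phi>\<in>test_functions. u (\<lambda>x. a * \<phi> x) = a * u \<phi>) \<and>
     (\<forall>K. compact K \<longrightarrow>
        (\<exists>C N. \<forall>\<phi>\<in>test_functions. supp \<phi> \<subseteq> K \<longrightarrow> norm (u \<phi>) \<le> C * test_seminorm N \<phi>))"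

definition dist_eq ::
    "(('a::euclidean_space \<Rightarrow> complex) \<Rightarrow> complex) \<Rightarrow> (('a \<Rightarrow> complex) \<Rightarrow> complex) \<Rightarrow> bool" where
  "dist_eq u w \<longleftrightarrow> (\<forall>\<phi>\<in>test_functions. u \<phi> = w \<phi>)"

definition regular_dist :: "(real \<Rightarrow> real) \<Rightarrow> (real \<Rightarrow> complex) \<Rightarrow> complex" where
  "regular_dist F \<phi> = (LINT x|lborel. of_real (F x) * \<phi> x)"

definition dirac :: "real \<Rightarrow> (real \<Rightarrow> complex) \<Rightarrow> complex" where
  "dirac a \<phi> = \<phi> a"

definition convolution ::
    "((real \<Rightarrow> complex) \<Rightarrow> complex) \<Rightarrow> (real \<Rightarrow> complex) \<Rightarrow> real \<Rightarrow> complex" where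
  "convolution u \<phi> = (\<lambda>x. u (\<lambda>y. \<phi> (x - y)))"

definition bessel_I0 :: "real \<Rightarrow> real" where
  "bessel_I0 z = (\<Sum>m. (z / 2) ^ (2 * m) / (fact m)\<^sup>2)"

text \<open>\<open>I\<^sub>0'(2\<alpha>z)/z\<close>, with its limit \<open>\<alpha>\<close> as the value at \<open>z = 0\<close>.\<close>

definition bessel_quot :: "real \<Rightarrow> real \<Rightarrow> real" where
  "bessel_quot \<alpha> z = (if z = 0 then \<alpha> else deriv bessel_I0 (2 * \<alpha> * z) / z)"

definition psi_fun :: "real \<Rightarrow> real \<Rightarrow> real \<Rightarrow> real \<Rightarrow> real" where
  "psi_fun k c t x =
     (let \<alpha> = k / (4 * c) in
      sgn t * (1 / (2 * c)) * bessel_I0 (2 * \<alpha> * sqrt (c\<^sup>2 * t\<^sup>2 - x\<^sup>2))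
        * indicator {- (c * \<bar>t\<bar>) .. c * \<bar>t\<bar>} x)"

definition psi :: "real \<Rightarrow> real \<Rightarrow> real \<Rightarrow> (real \<Rightarrow> complex) \<Rightarrow> complex" where
  "psi k c t = regular_dist (psi_fun k c t)"

definition psi_t_fun :: "real \<Rightarrow> real \<Rightarrow> real \<Rightarrow> real \<Rightarrow> real" where
  "psi_t_fun k c t x =
     (let \<alpha> = k / (4 * c) in
      \<alpha> * c * \<bar>t\<bar> * bessel_quot \<alpha> (sqrt (c\<^sup>2 * t\<^sup>2 - x\<^sup>2))
        * indicator {- (c * \<bar>t\<bar>) .. c * \<bar>t\<bar>} x)"

definition psi_t :: "real \<Rightarrow> real \<Rightarrow> real \<Rightarrow> (real \<Rightarrow> complex) \<Rightarrow> complex" where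
  "psi_t k c t \<phi> =
     (1/2) * (dirac (c * t) \<phi> + dirac (- (c * t)) \<phi>) + regular_dist (psi_t_fun k c t) \<phi>"

text \<open>\<open>C1_dist v v\<^sub>t\<close>: \<open>v\<close> belongs to \<open>C\<^sup>1(\<real>, D'(\<real>))\<close> with time derivative \<open>v\<^sub>t\<close>.\<close>

definition C1_dist ::
    "(real \<Rightarrow> (real \<Rightarrow> complex) \<Rightarrow> complex) \<Rightarrow> (real \<Rightarrow> (real \<Rightarrow> complex) \<Rightarrow> complex) \<Rightarrow> bool" where
  "C1_dist v v\<^sub>t \<longleftrightarrow>
     (\<forall>t. distribution (v t)) \<and> (\<forall>t. distribution (v\<^sub>t t)) \<and>
     (\<forall>\<phi>\<in>test_functions. \<forall>t.
        ((\<lambda>h. (v (t + h) \<phi> - v t \<phi>) / of_real h) \<longlongrightarrow> v\<^sub>t t \<phi>) (at 0) \<and>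
        ((\<lambda>h. v\<^sub>t (t + h) \<phi>) \<longlongrightarrow> v\<^sub>t t \<phi>) (at 0))"

text \<open>Points of the plane are pairs \<open>(x, t)\<close>. Bochner integrability of the pairing in \<open>t\<close> is
  part of the requirement, since the HOL integral of a non-integrable function is \<open>0\<close>.\<close>

definition weak_solution ::
    "real \<Rightarrow> real \<Rightarrow> (real \<Rightarrow> (real \<Rightarrow> complex) \<Rightarrow> complex) \<Rightarrow> bool" where
  "weak_solution k c v \<longleftrightarrow>
     (\<forall>\<phi> \<in> (test_functions :: (real \<times> real \<Rightarrow> complex) set).
        has_bochner_integral lborel
          (\<lambda>t. v t (\<lambda>x. partial_derivs [(0, 1), (0, 1)] \<phi> (x, t)
                        - of_real (c\<^sup>2) * partial_derivs [(1, 0), (1, 0)] \<phi> (x, t)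
                        - of_real (k\<^sup>2 / 4) * \<phi> (x, t)))
          0)"

end

theory Submission
  imports Defs
begin

text \<open>
  Substituting \<open>y = c t s\<close>, convolution with \<open>\<psi>(t)\<close> and \<open>\<psi>\<^sub>t(t)\<close> becomes averaging over \<open>s \<in> [-1, 1]\<close>
  against kernels that are smooth in \<open>t\<close>. Call these operators \<open>W(t)\<close> and \<open>V(t)\<close>, and let
  \<open>L = c\<^sup>2 \<partial>\<^sub>x\<^sup>2 + k\<^sup>2 / 4\<close>. Differentiation under the integral and one integration by parts in \<open>s\<close> give
  \<open>W' = V\<close>, and Bessel's equation gives \<open>V' = W L\<close>, both with convergence in the space of test
  functions; more generally the product rule holds on curves \<open>\<phi>\<^sub>t\<close> of test functions. Distributions
  turn these into derivatives of scalar functions, so with \<open>h = g + (k/2) f\<close> the map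
  \<open>v(t) = f \<circ> V(t) + h \<circ> W(t)\<close> has time derivative \<open>f \<circ> W(t) L + h \<circ> V(t)\<close>. For a test
  function \<open>\<phi>\<close> of the plane, \<open>\<langle>v, \<partial>\<^sub>t\<phi>\<rangle> - \<langle>v\<^sub>t, \<phi>\<rangle>\<close> has compact support in \<open>t\<close> and derivative
  \<open>\<langle>v, \<partial>\<^sub>t\<partial>\<^sub>t\<phi> - L\<phi>\<rangle>\<close>, which therefore integrates to \<open>0\<close>.
\<close>

subsection \<open>Test functions and distributions on the line\<close>

text \<open>The formula for psi is singular in three ways: \<open>sgn t\<close> jumps at t = 0, the
  square root degenerates on the cone |x| = c |t|, and the support has moving edges. The
  substitution removes all three: the Jacobian turns sgn t into t, evenness of I_0 leaves the entire
  function J with I_0(z) = J(z^2 / 4), taken at w = a^2 t^2 (1 - s^2) with a = alpha c = k / 4, and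
  the interval stands still. The Dirac masses of psi_t come back as boundary terms, because w = 0
  and J(0) = 1 at s = -1 and s = 1. For V' the boundary terms cancel against the derivatives of the
  two translates, and J' + w J'' = J produces the term k^2 / 4 = 4 a^2.

  Since f and g are arbitrary distributions, pointwise differentiation is not enough: difference
  quotients must converge uniformly in x, with every x-derivative and with supports in one compact
  set. W, V and L commute with d/dx, so one formula indexed by the order n provides this. The weak
  equation pairs v(t) with a test function that itself moves with t, hence the product rule along
  curves.\<close>

definition nth_deriv :: "nat \<Rightarrow> (real \<Rightarrow> complex) \<Rightarrow> real \<Rightarrow> complex" where
  "nth_deriv n \<phi> = partial_derivs (replicate n 1) \<phi>"

lemma nth_deriv_0 [simp]: "nth_deriv 0 \<phi> = \<phi>"
  by (simp add: nth_deriv_def partial_derivs_def)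

lemma nth_deriv_Suc: "nth_deriv (Suc n) \<phi> = dir_deriv 1 (nth_deriv n \<phi>)"
  by (simp add: nth_deriv_def partial_derivs_def)

lemma dir_deriv_has_derivative:
  assumes "(\<phi> has_derivative D) (at x)"
  shows "dir_deriv b \<phi> x = D b"
  using frechet_derivative_at[OF assms] by (simp add: dir_deriv_def)

lemma set_subset_Basis_real:
  "set bs \<subseteq> (Basis :: real set) \<longleftrightarrow> bs = replicate (length bs) 1"
proof
  assume "set bs \<subseteq> (Basis :: real set)"
  then have "\<forall>y\<in>set bs. y = 1" by auto
  then show "bs = replicate (length bs) 1"
    by (metis replicate_length_same)
next
  assume "bs = replicate (length bs) 1"
  then have "set bs \<subseteq> {1}" by (metis set_replicate_conv_if empty_subsetI order_refl)
  then show "set bs \<subseteq> Basis" by simp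
qed

lemma smooth_real_iff:
  "smooth \<phi> \<longleftrightarrow> (\<forall>n x. nth_deriv n \<phi> differentiable (at x))"
proof
  assume *: "smooth \<phi>"
  have "replicate n 1 \<in> lists (Basis :: real set)" for n by (auto simp: in_lists_conv_set)
  with * show "\<forall>n x. nth_deriv n \<phi> differentiable (at x)" by (simp add: smooth_def nth_deriv_def)
next
  assume *: "\<forall>n x. nth_deriv n \<phi> differentiable (at x)"
  have "partial_derivs bs \<phi> differentiable (at x)" if "bs \<in> lists Basis" for bs x
  proof -
    from that have "bs = replicate (length bs) 1"
      using set_subset_Basis_real[of bs] by (auto simp: in_lists_conv_set)
    with * show ?thesis by (metis nth_deriv_def)
  qed
  then show "smooth \<phi>" by (simp add: smooth_def)
qed

lemma smooth_has_vector_derivative: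
  assumes "smooth \<phi>"
  shows "(nth_deriv n \<phi> has_vector_derivative nth_deriv (Suc n) \<phi> x) (at x)"
proof -
  from assms obtain D where D: "(nth_deriv n \<phi> has_derivative D) (at x)"
    by (metis smooth_real_iff differentiable_def)
  interpret D: bounded_linear D using D by (rule has_derivative_bounded_linear)
  have "D h = h *\<^sub>R nth_deriv (Suc n) \<phi> x" for h
    using D.scaleR[of h 1] by (simp add: nth_deriv_Suc dir_deriv_has_derivative[OF D])
  then have "D = (\<lambda>h. h *\<^sub>R nth_deriv (Suc n) \<phi> x)" by auto
  with D show ?thesis by (simp add: has_vector_derivative_def)
qed

text \<open>Smoothness by exhibiting all derivatives: uniqueness of derivatives forces
  \<open>d n\<close> to be the n-th derivative of \<open>d 0\<close>, so an explicit formula for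
  each order replaces computing with \<open>frechet_derivative\<close>.\<close>

definition deriv_family :: "(nat \<Rightarrow> real \<Rightarrow> complex) \<Rightarrow> bool" where
  "deriv_family d \<longleftrightarrow> (\<forall>n x. (d n has_vector_derivative d (Suc n) x) (at x))"

lemma deriv_family_nth_deriv: "smooth \<phi> \<Longrightarrow> deriv_family (\<lambda>n. nth_deriv n \<phi>)"
  by (simp add: deriv_family_def smooth_has_vector_derivative)

lemma nth_deriv_deriv_family:
  assumes "deriv_family d"
  shows "nth_deriv n (d 0) = d n"
proof (induction n)
  case (Suc n)
  have "dir_deriv 1 (d n) x = d (Suc n) x" for x
    using assms dir_deriv_has_derivative[of "d n" _ x 1]
    by (force simp: deriv_family_def has_vector_derivative_def)
  with Suc show ?case by (auto simp: nth_deriv_Suc)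
qed simp

lemma smooth_deriv_family: "deriv_family d \<Longrightarrow> smooth (d 0)"
  by (auto simp: smooth_real_iff nth_deriv_deriv_family deriv_family_def
      intro: differentiableI_vector)

lemma supp_subset_cball:
  fixes \<phi> :: "real \<Rightarrow> complex"
  assumes "\<And>x. \<bar>x\<bar> > R \<Longrightarrow> \<phi> x = 0"
  shows "supp \<phi> \<subseteq> cball 0 R"
  unfolding supp_def
  by (rule closure_minimal) (use assms in \<open>force simp: support_on_def not_le[symmetric]\<close>)+

lemma supp_outside:
  fixes \<phi> :: "'a::euclidean_space \<Rightarrow> complex"
  assumes "x \<notin> supp \<phi>"
  shows "\<phi> x = 0"
  using assms closure_subset[of "support_on UNIV \<phi>"] by (auto simp: supp_def support_on_def)

lemma test_functionI:
  assumes "deriv_family d" "\<And>x. \<bar>x\<bar> > R \<Longrightarrow> d 0 x = 0"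
  shows "d 0 \<in> test_functions"
proof -
  have "compact (supp (d 0))"
    using supp_subset_cball[of R "d 0"] assms(2)
    by (auto simp: supp_def compact_eq_bounded_closed intro: bounded_subset[OF bounded_cball])
  then show ?thesis using assms(1) by (simp add: test_functions_def smooth_deriv_family)
qed

lemma test_functionE:
  assumes "\<phi> \<in> test_functions"
  obtains R where "\<And>x :: 'a::euclidean_space. norm x > R \<Longrightarrow> \<phi> x = 0"
proof -
  have "bounded (supp \<phi>)" using assms by (auto simp: test_functions_def compact_imp_bounded)
  then obtain R where "\<And>x. x \<in> supp \<phi> \<Longrightarrow> norm x \<le> R" by (auto simp: bounded_iff)
  then show ?thesis by (intro that[of R]) (meson supp_outside not_le)
qed

lemma test_function_real_outside:
  assumes "\<phi> \<in> test_functions"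
  shows "\<exists>R. \<forall>x :: real. \<bar>x\<bar> > R \<longrightarrow> \<phi> x = 0"
proof (rule test_functionE[OF assms])
  fix R assume "\<And>x. norm x > R \<Longrightarrow> \<phi> x = 0"
  then show ?thesis by (intro exI[of _ R]) simp
qed

lemma test_function_family:
  "\<phi> \<in> test_functions \<Longrightarrow> deriv_family (\<lambda>n. nth_deriv n \<phi>)"
  by (simp add: test_functions_def deriv_family_nth_deriv)

text \<open>The set |x| > R is open, so vanishing there passes to the derivative, and by induction
  to all orders.\<close>

lemma deriv_family_outside:
  assumes "deriv_family d" "\<And>x. \<bar>x\<bar> > R \<Longrightarrow> d 0 x = 0" "\<bar>x\<bar> > R"
  shows "d n x = 0"
  using assms(3)
proof (induction n arbitrary: x)
  case (Suc n)
  have "open {x :: real. \<bar>x\<bar> > R}" by (intro open_Collect_less continuous_intros)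
  then have "(d n has_vector_derivative 0) (at x)"
    by (rule has_vector_derivative_transform_within_open[OF has_vector_derivative_const])
      (use Suc in auto)
  moreover have "(d n has_vector_derivative d (Suc n) x) (at x)"
    using assms(1) by (simp add: deriv_family_def)
  ultimately show ?case by (metis vector_derivative_at)
qed (use assms in auto)

lemma deriv_family_bounded:
  assumes "deriv_family d" "\<And>x. \<bar>x\<bar> > R \<Longrightarrow> d 0 x = 0"
  shows "bounded (range (d n))"
proof -
  have "continuous_on {-R..R} (d n)"
    using assms(1) by (auto simp: deriv_family_def
        intro!: has_vector_derivative_continuous continuous_at_imp_continuous_on)
  then have "bounded (insert 0 (d n ` {-R..R}))"
    by (simp add: compact_continuous_image compact_imp_bounded)
  moreover have "range (d n) \<subseteq> insert 0 (d n ` {-R..R})"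
    proof
    fix y assume "y \<in> range (d n)"
    then obtain x where "y = d n x" by blast
    then show "y \<in> insert 0 (d n ` {-R..R})"
      using deriv_family_outside[OF assms, where R = R and x = x and n = n] by (cases "\<bar>x\<bar> > R") (auto simp: not_less abs_le_iff intro!: image_eqI[of _ _ x])
  qed
  ultimately show ?thesis by (rule bounded_subset)
qed

section \<open>Seminorms and the continuity estimate for distributions\<close>

lemma test_seminorm_real:
  "test_seminorm N \<phi> = (\<Sum>n\<le>N. SUP x. norm (nth_deriv n \<phi> x))"
  unfolding test_seminorm_def
  by (rule sum.reindex_bij_witness[of _ "\<lambda>n. replicate n 1" length])
    (use set_subset_Basis_real in \<open>auto simp: nth_deriv_def\<close>)

lemma test_seminorm_le:
  assumes "deriv_family d" "\<And>n x. n \<le> N \<Longrightarrow> norm (d n x) \<le> B"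
  shows "test_seminorm N (d 0) \<le> real (Suc N) * B"
proof -
  have "(SUP x. norm (nth_deriv n (d 0) x)) \<le> B" if "n \<le> N" for n
    by (rule cSUP_least) (use assms that in \<open>auto simp: nth_deriv_deriv_family\<close>)
  then have "test_seminorm N (d 0) \<le> (\<Sum>n\<le>N. B)"
    unfolding test_seminorm_real by (intro sum_mono) auto
  then show ?thesis by simp
qed

lemma norm_nth_deriv_le_seminorm:
  assumes \<phi>: "\<phi> \<in> test_functions" and "n \<le> N"
  shows "norm (nth_deriv n \<phi> x) \<le> test_seminorm N \<phi>"
proof -
  obtain R where R: "\<And>x. \<bar>x\<bar> > R \<Longrightarrow> \<phi> x = 0" using test_function_real_outside[OF \<phi>] by blast
  \<comment> \<open>\<open>SUP\<close> of an unbounded set of reals carries no information. Compact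
    support bounds every derivative, and only then does the supremum dominate its members.\<close>
  have bdd: "bdd_above (range (\<lambda>x. norm (nth_deriv n \<phi> x)))" for n
    using deriv_family_bounded[OF test_function_family[OF \<phi>], of R n] R
    by (auto simp: bounded_iff bdd_above_def)
  have nn: "0 \<le> (SUP x. norm (nth_deriv n \<phi> x))" for n
    using cSUP_upper2[OF bdd, of 0 0 n] by simp
  have "norm (nth_deriv n \<phi> x) \<le> (SUP x. norm (nth_deriv n \<phi> x))"
    by (rule cSUP_upper[OF _ bdd]) simp
  also have "\<dots> \<le> test_seminorm N \<phi>"
    unfolding test_seminorm_real
    by (rule member_le_sum[where f = "\<lambda>n. SUP x. norm (nth_deriv n \<phi> x)"]) (use \<open>n \<le> N\<close> nn in auto)
  finally show ?thesis .
qed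

lemma test_functions_lincomb:
  assumes "\<phi> \<in> test_functions" "\<eta> \<in> test_functions"
  shows "(\<lambda>x. a * \<phi> x + b * \<eta> x) \<in> (test_functions :: (real \<Rightarrow> complex) set)"
proof -
  obtain R S where R: "\<And>x. \<bar>x\<bar> > R \<Longrightarrow> \<phi> x = 0" and S: "\<And>x. \<bar>x\<bar> > S \<Longrightarrow> \<eta> x = 0"
    using assms[THEN test_function_real_outside] by blast
  have "deriv_family (\<lambda>n x. a * nth_deriv n \<phi> x + b * nth_deriv n \<eta> x)"
    using test_function_family[OF assms(1)] test_function_family[OF assms(2)]
    by (auto simp: deriv_family_def intro!: derivative_eq_intros)
  from test_functionI[OF this, of "max R S"] R S show ?thesis by simp
qed

lemma distribution_lincomb:
  assumes "distribution u" "\<phi> \<in> test_functions" "\<eta> \<in> test_functions"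
  shows "u (\<lambda>x. a * \<phi> x + b * \<eta> x) = a * u \<phi> + b * u (\<eta> :: real \<Rightarrow> complex)"
proof -
  have *: "(\<lambda>x. a * \<phi> x) \<in> test_functions" "(\<lambda>x. b * \<eta> x) \<in> test_functions"
    using test_functions_lincomb[OF assms(2) assms(2), of a 0]
      test_functions_lincomb[OF assms(3) assms(3), of b 0] by simp_all
  have "u (\<lambda>x. a * \<phi> x + b * \<eta> x) = u (\<lambda>x. a * \<phi> x) + u (\<lambda>x. b * \<eta> x)"
    using assms(1) * by (simp add: distribution_def)
  also have "\<dots> = a * u \<phi> + b * u \<eta>"
    using assms by (simp add: distribution_def)
  finally show ?thesis .
qed

lemma distribution_zero:
  assumes "distribution u"
  shows "u (\<lambda>x::real. 0) = 0"
proof -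
  have "(\<lambda>x::real. 0) \<in> test_functions"
    using test_functionI[of "\<lambda>n x. 0" 0] by (simp add: deriv_family_def)
  from distribution_lincomb[OF assms this this, of 0 0] show ?thesis by simp
qed

text \<open>The continuity condition of \<open>distribution\<close> on one interval [-R, R], with
  suprema and \<open>supp\<close> replaced by a common pointwise bound \<open>B\<close> and
  vanishing beyond \<open>R\<close>.\<close>

definition order_bound :: "((real \<Rightarrow> complex) \<Rightarrow> complex) \<Rightarrow> real \<Rightarrow> real \<Rightarrow> nat \<Rightarrow> bool" where
  "order_bound u R C N \<longleftrightarrow> (\<forall>d B. deriv_family d \<longrightarrow> (\<forall>x. \<bar>x\<bar> > R \<longrightarrow> d 0 x = 0) \<longrightarrow>
      (\<forall>n\<le>N. \<forall>x. norm (d n x) \<le> B) \<longrightarrow> norm (u (d 0)) \<le> C * B)"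

lemma order_boundD:
  assumes "order_bound u R C N" "deriv_family d" "\<And>x. \<bar>x\<bar> > R \<Longrightarrow> d 0 x = 0"
    and "\<And>n x. n \<le> N \<Longrightarrow> norm (d n x) \<le> B"
  shows "norm (u (d 0)) \<le> C * B"
  using assms unfolding order_bound_def by simp

lemma distribution_bound:
  assumes "distribution u"
  shows "\<exists>C\<ge>0. \<exists>N. order_bound u R C N"
proof -
  have "\<exists>C N. \<forall>\<phi>\<in>test_functions. supp \<phi> \<subseteq> cball 0 R \<longrightarrow> norm (u \<phi>) \<le> C * test_seminorm N \<phi>"
    using assms by (simp add: distribution_def)
  then obtain C N where C: "\<And>\<phi>. \<phi> \<in> test_functions \<Longrightarrow> supp \<phi> \<subseteq> cball 0 R \<Longrightarrow>
      norm (u \<phi>) \<le> C * test_seminorm N \<phi>"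
    by blast
  show ?thesis
    unfolding order_bound_def
  proof (intro exI[of _ "\<bar>C\<bar> * real (Suc N)"] conjI exI[of _ N] allI impI)
    fix d B assume d: "deriv_family d" "\<forall>x. \<bar>x\<bar> > R \<longrightarrow> d 0 x = 0"
      and B: "\<forall>n\<le>N. \<forall>x. norm (d n x) \<le> B"
    have t: "d 0 \<in> test_functions" using test_functionI[of d R] d by blast
    have "norm (u (d 0)) \<le> C * test_seminorm N (d 0)"
      using C[OF t] supp_subset_cball[of R "d 0"] d(2) by blast
    also have "\<dots> \<le> \<bar>C\<bar> * test_seminorm N (d 0)"
      using norm_nth_deriv_le_seminorm[OF t, of 0 N 0]
      by (intro mult_right_mono) (auto intro: order_trans[OF norm_ge_zero])
    also have "\<dots> \<le> \<bar>C\<bar> * (real (Suc N) * B)"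
      by (intro mult_left_mono test_seminorm_le d(1)) (use B in auto)
    finally show "norm (u (d 0)) \<le> \<bar>C\<bar> * real (Suc N) * B" by (simp only: mult.assoc)
  qed simp
qed

text \<open>The functional \<open>z\<close> is known only on test functions, as \<open>v\<close> is
  in the theorem. For continuity the larger of the two orders serves both summands.\<close>

lemma distribution_lincombI:
  assumes "distribution u" "distribution w"
    and "\<And>\<phi>. \<phi> \<in> test_functions \<Longrightarrow> z \<phi> = a * u \<phi> + b * w \<phi>"
  shows "distribution (z :: (real \<Rightarrow> complex) \<Rightarrow> complex)"
  unfolding distribution_def
proof (intro conjI ballI allI impI)
  fix \<phi> \<eta> :: "real \<Rightarrow> complex" assume *: "\<phi> \<in> test_functions" "\<eta> \<in> test_functions"
  then have "(\<lambda>x. \<phi> x + \<eta> x) \<in> test_functions" using test_functions_lincomb[of \<phi> \<eta> 1 1] by simp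
  then show "z (\<lambda>x. \<phi> x + \<eta> x) = z \<phi> + z \<eta>"
    using distribution_lincomb[OF assms(1) *, of 1 1] distribution_lincomb[OF assms(2) *, of 1 1] *
    by (simp add: assms(3) algebra_simps)
next
  fix \<phi> :: "real \<Rightarrow> complex" and s assume *: "\<phi> \<in> test_functions"
  then have "(\<lambda>x. s * \<phi> x) \<in> test_functions" using test_functions_lincomb[of \<phi> \<phi> s 0] by simp
  then show "z (\<lambda>x. s * \<phi> x) = s * z \<phi>"
    using distribution_lincomb[OF assms(1) * *, of s 0] distribution_lincomb[OF assms(2) * *, of s 0] *
    by (simp add: assms(3) algebra_simps)
next
  fix K :: "real set" assume "compact K"
  then obtain R where R: "\<And>x. x \<in> K \<Longrightarrow> \<bar>x\<bar> \<le> R" using compact_imp_bounded[of K] by (auto simp: bounded_iff)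
  obtain C N where CN: "C \<ge> 0" "order_bound u R C N"
    using distribution_bound[OF assms(1), of R] by blast
  obtain C' N' where CN': "C' \<ge> 0" "order_bound w R C' N'"
    using distribution_bound[OF assms(2), of R] by blast
  show "\<exists>C N. \<forall>\<phi>\<in>test_functions. supp \<phi> \<subseteq> K \<longrightarrow> norm (z \<phi>) \<le> C * test_seminorm N \<phi>"
  proof (intro exI ballI impI)
    fix \<phi> :: "real \<Rightarrow> complex" assume \<phi>: "\<phi> \<in> test_functions" "supp \<phi> \<subseteq> K"
    let ?B = "test_seminorm (max N N') \<phi>"
    have out: "\<bar>x\<bar> > R \<Longrightarrow> \<phi> x = 0" for x using supp_outside[of x \<phi>] R \<phi>(2) by force
    have "norm (u \<phi>) \<le> C * ?B"
      using order_boundD[OF CN(2) test_function_family[OF \<phi>(1)], of ?B] out norm_nth_deriv_le_seminorm[OF \<phi>(1), of _ "max N N'"] by simp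
    moreover have "norm (w \<phi>) \<le> C' * ?B"
      using order_boundD[OF CN'(2) test_function_family[OF \<phi>(1)], of ?B] out norm_nth_deriv_le_seminorm[OF \<phi>(1), of _ "max N N'"] by simp
    ultimately have "norm (z \<phi>) \<le> norm a * (C * ?B) + norm b * (C' * ?B)"
      unfolding assms(3)[OF \<phi>(1)]
      by (intro order_trans[OF norm_triangle_ineq] add_mono) (auto simp: norm_mult intro!: mult_left_mono)
    then show "norm (z \<phi>) \<le> (norm a * C + norm b * C') * ?B" by (simp add: algebra_simps)
  qed
qed

text \<open>The transpose of a continuous linear operator on test functions maps distributions to
  distributions. The operator enlarges supports by at most \<open>R\<close> and costs
  \<open>m\<close> derivatives with factor \<open>M\<close>; \<open>P \<phi> n\<close> is the n-th
  derivative of its value at \<open>\<phi>\<close>.\<close>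

lemma distribution_compose:
  fixes u :: "(real \<Rightarrow> complex) \<Rightarrow> complex"
    and P :: "(real \<Rightarrow> complex) \<Rightarrow> nat \<Rightarrow> real \<Rightarrow> complex"
  assumes u: "distribution u"
    and family: "\<And>\<phi>. \<phi> \<in> test_functions \<Longrightarrow> deriv_family (P \<phi>)"
    and outside: "\<And>\<phi> \<rho> x. \<lbrakk>\<phi> \<in> test_functions; \<And>x. \<bar>x\<bar> > \<rho> \<Longrightarrow> \<phi> x = 0; \<bar>x\<bar> > \<rho> + R\<rbrakk> \<Longrightarrow> P \<phi> 0 x = 0"
    and bound: "\<And>\<phi> n x B. \<lbrakk>\<phi> \<in> test_functions; \<And>j x. j \<le> m \<Longrightarrow> norm (nth_deriv (n + j) \<phi> x) \<le> B\<rbrakk> \<Longrightarrow>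
        norm (P \<phi> n x) \<le> M * B"
    and lin: "\<And>\<phi> \<eta> a b. \<lbrakk>\<phi> \<in> test_functions; \<eta> \<in> test_functions\<rbrakk> \<Longrightarrow>
        P (\<lambda>x. a * \<phi> x + b * \<eta> x) 0 = (\<lambda>x. a * P \<phi> 0 x + b * P \<eta> 0 x)"
    and z: "\<And>\<phi>. \<phi> \<in> test_functions \<Longrightarrow> z \<phi> = u (P \<phi> 0)"
  shows "distribution z"
  unfolding distribution_def
proof (intro conjI ballI allI impI)
  have test: "P \<phi> 0 \<in> test_functions" if \<phi>: "\<phi> \<in> test_functions" for \<phi>
  proof -
    obtain \<rho> where "\<And>x. \<bar>x\<bar> > \<rho> \<Longrightarrow> \<phi> x = 0" using test_function_real_outside[OF \<phi>] by blast
    then show ?thesis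
      by (intro test_functionI[where R = "\<rho> + R"] family \<phi> outside[where \<rho> = \<rho>]) auto
  qed
  have lincomb: "z (\<lambda>x. a * \<phi> x + b * \<eta> x) = a * z \<phi> + b * z \<eta>"
    if \<phi>: "\<phi> \<in> test_functions" and \<eta>: "\<eta> \<in> test_functions" for a b \<phi> \<eta>
    using z[OF test_functions_lincomb[OF \<phi> \<eta>]] lin[OF \<phi> \<eta>] z[OF \<phi>] z[OF \<eta>]
      distribution_lincomb[OF u test[OF \<phi>] test[OF \<eta>]] by simp
  {
    fix \<phi> \<eta> :: "real \<Rightarrow> complex" assume "\<phi> \<in> test_functions" "\<eta> \<in> test_functions"
    then show "z (\<lambda>x. \<phi> x + \<eta> x) = z \<phi> + z \<eta>" using lincomb[of \<phi> \<eta> 1 1] by simp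
  next
    fix \<phi> :: "real \<Rightarrow> complex" and a assume "\<phi> \<in> test_functions"
    then show "z (\<lambda>x. a * \<phi> x) = a * z \<phi>" using lincomb[of \<phi> \<phi> a 0] by simp
  }
next
  fix K :: "real set" assume K: "compact K"
  obtain \<rho> where \<rho>: "\<And>x. x \<in> K \<Longrightarrow> \<bar>x\<bar> \<le> \<rho>" using compact_imp_bounded[OF K] by (auto simp: bounded_iff)
  obtain C N where CN: "C \<ge> 0" "order_bound u (\<rho> + R) C N"
    using distribution_bound[OF u, of "\<rho> + R"] by blast
  show "\<exists>C N. \<forall>\<phi>\<in>test_functions. supp \<phi> \<subseteq> K \<longrightarrow> norm (z \<phi>) \<le> C * test_seminorm N \<phi>"
  proof (intro exI ballI impI)
    fix \<phi> :: "real \<Rightarrow> complex" assume \<phi>: "\<phi> \<in> test_functions" "supp \<phi> \<subseteq> K"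
    have out: "\<bar>x\<bar> > \<rho> \<Longrightarrow> \<phi> x = 0" for x using supp_outside[of x \<phi>] \<rho> \<phi>(2) by force
    have "norm (u (P \<phi> 0)) \<le> C * (M * test_seminorm (N + m) \<phi>)"
    proof (rule order_boundD[OF CN(2)])
      show "deriv_family (P \<phi>)" by (rule family[OF \<phi>(1)])
      show "P \<phi> 0 x = 0" if "\<bar>x\<bar> > \<rho> + R" for x
        by (rule outside[OF \<phi>(1) out that])
      show "norm (P \<phi> n x) \<le> M * test_seminorm (N + m) \<phi>" if "n \<le> N" for n x
        by (rule bound[OF \<phi>(1)]) (use that in \<open>intro norm_nth_deriv_le_seminorm[OF \<phi>(1)], simp\<close>)
    qed
    then show "norm (z \<phi>) \<le> (C * M) * test_seminorm (N + m) \<phi>" by (simp add: z[OF \<phi>(1)] mult_ac)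
  qed
qed

lemma distribution_lincomb_scaleR:
  assumes "distribution u" "\<phi> \<in> test_functions" "\<eta> \<in> test_functions"
  shows "u (\<lambda>x. a *\<^sub>R \<phi> x + b *\<^sub>R \<eta> x) = a *\<^sub>R u \<phi> + b *\<^sub>R u (\<eta> :: real \<Rightarrow> complex)"
  using distribution_lincomb[OF assms, of "of_real a" "of_real b"] by (simp add: scaleR_conv_of_real)

subsection \<open>Curves of test functions\<close>

text \<open>A curve \<open>t \<mapsto> E 0 t\<close> of test functions is carried along with all its spatial
  derivatives: \<open>E n t x\<close> is the \<open>n\<close>-th \<open>x\<close>-derivative at time \<open>t\<close>. Operators that commute with
  \<open>\<partial>\<^sub>x\<close> then act on all orders \<open>n\<close> by one formula.\<close>

definition test_curve :: "(nat \<Rightarrow> real \<Rightarrow> real \<Rightarrow> complex) \<Rightarrow> bool" where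
  "test_curve E \<longleftrightarrow> (\<forall>t. deriv_family (\<lambda>n. E n t)) \<and>
     (\<forall>n. continuous_on UNIV (\<lambda>(t, x). E n t x)) \<and>
     (\<forall>T. \<exists>R. \<forall>t x. \<bar>t\<bar> \<le> T \<longrightarrow> \<bar>x\<bar> > R \<longrightarrow> E 0 t x = 0)"

definition curve_deriv ::
    "(nat \<Rightarrow> real \<Rightarrow> real \<Rightarrow> complex) \<Rightarrow> (nat \<Rightarrow> real \<Rightarrow> real \<Rightarrow> complex) \<Rightarrow> bool" where
  "curve_deriv E E' \<longleftrightarrow> test_curve E \<and> test_curve E' \<and>
     (\<forall>n t x. ((\<lambda>t. E n t x) has_vector_derivative E' n t x) (at t))"

lemma test_curve_family: "test_curve E \<Longrightarrow> deriv_family (\<lambda>n. E n t)"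
  by (simp add: test_curve_def)

lemma test_curve_vector_derivative:
  "test_curve E \<Longrightarrow> (E n t has_vector_derivative E (Suc n) t x) (at x)"
  by (simp add: test_curve_def deriv_family_def)

lemma test_curve_continuous:
  assumes "test_curve E" "continuous_on S f" "continuous_on S g"
  shows "continuous_on S (\<lambda>z. E n (f z) (g z))"
proof -
  have "continuous_on UNIV (\<lambda>(t, x). E n t x)" using assms(1) by (simp add: test_curve_def)
  from continuous_on_compose2[OF this continuous_on_Pair[OF assms(2,3)]] show ?thesis by simp
qed

lemma test_curve_outside:
  assumes "test_curve E"
  shows "\<exists>R. \<forall>n t x. \<bar>t\<bar> \<le> T \<longrightarrow> \<bar>x\<bar> > R \<longrightarrow> E n t x = 0"
proof -
  obtain R where R: "\<forall>t x. \<bar>t\<bar> \<le> T \<longrightarrow> \<bar>x\<bar> > R \<longrightarrow> E 0 t x = 0"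
    using assms unfolding test_curve_def by blast
  show ?thesis
  proof (intro exI[of _ R] allI impI)
    fix n t x assume "\<bar>t\<bar> \<le> T" "\<bar>x\<bar> > R"
    then show "E n t x = 0"
      using R deriv_family_outside[OF test_curve_family[OF assms], of R t x n] by blast
  qed
qed

lemma test_curve_test_function:
  assumes "test_curve E"
  shows "E 0 t \<in> test_functions"
proof -
  obtain R where "\<forall>n t' x. \<bar>t'\<bar> \<le> \<bar>t\<bar> \<longrightarrow> \<bar>x\<bar> > R \<longrightarrow> E n t' x = 0"
    using test_curve_outside[OF assms] by blast
  then show ?thesis by (intro test_functionI[OF test_curve_family[OF assms], of R]) simp
qed

lemma curve_derivD:
  assumes "curve_deriv E E'"
  shows "test_curve E" "test_curve E'" "((\<lambda>t. E n t x) has_vector_derivative E' n t x) (at t)"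
  using assms by (simp_all add: curve_deriv_def)

text \<open>For s within 1 of t the supports lie in one interval, so uniform continuity on a compact
  rectangle gives a bound valid for all x.\<close>

lemma test_curve_uniformly_continuous:
  assumes "test_curve E" "e > 0"
  shows "\<exists>d>0. \<forall>s x. \<bar>s - t\<bar> < d \<longrightarrow> norm (E n s x - E n t x) \<le> e"
proof -
  obtain R where R: "\<forall>n s x. \<bar>s\<bar> \<le> \<bar>t\<bar> + 1 \<longrightarrow> \<bar>x\<bar> > R \<longrightarrow> E n s x = 0"
    using test_curve_outside[OF assms(1)] by blast
  let ?K = "{t - 1..t + 1} \<times> {-R..R}"
  have "uniformly_continuous_on ?K (\<lambda>z. E n (fst z) (snd z))"
    by (intro compact_uniformly_continuous test_curve_continuous[OF assms(1)] continuous_intros compact_Times) auto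
  then obtain d where d: "d > 0" "\<And>z w. \<lbrakk>z \<in> ?K; w \<in> ?K; dist w z < d\<rbrakk> \<Longrightarrow>
      dist (E n (fst w) (snd w)) (E n (fst z) (snd z)) < e"
    unfolding uniformly_continuous_on_def using assms(2) by meson
  show ?thesis
  proof (intro exI[of _ "min d 1"] conjI allI impI)
    fix s x assume s: "\<bar>s - t\<bar> < min d 1"
    show "norm (E n s x - E n t x) \<le> e"
    proof (cases "\<bar>x\<bar> > R")
      case True
      then show ?thesis using R s assms(2) by auto
    next
      case False
      then have "x \<in> {-R..R}" by auto
      with d(2)[of "(t, x)" "(s, x)"] s show ?thesis
        by (simp add: dist_Pair_Pair dist_norm abs_less_iff)
    qed
  qed (use d in auto)
qed

text \<open>With supports in one interval \<open>u\<close> sees only the orders up to some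
  \<open>N\<close>. These are finitely many, so smallness of each derivative separately
  suffices.\<close>

lemma distribution_tendsto_zero:
  assumes "distribution u"
    and family: "\<forall>\<^sub>F s in F. deriv_family (d s)"
    and outside: "\<forall>\<^sub>F s in F. \<forall>x. \<bar>x\<bar> > R \<longrightarrow> d s 0 x = 0"
    and small: "\<And>n e. e > 0 \<Longrightarrow> \<forall>\<^sub>F s in F. \<forall>x. norm (d s n x) \<le> e"
  shows "((\<lambda>s. u (d s 0)) \<longlongrightarrow> 0) F"
proof (rule tendstoI)
  fix e :: real assume "e > 0"
  obtain C N where C: "C \<ge> 0" "order_bound u R C N" using distribution_bound[OF assms(1)] by blast
  \<comment> \<open>Dividing by C + 1 keeps the tolerance meaningful and the final inequality strict
    even if C = 0.\<close>
  have e: "e / (C + 1) > 0" and Ce: "C * (e / (C + 1)) < e"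
    using \<open>e > 0\<close> C(1) by (auto simp: field_simps)
  have "\<forall>\<^sub>F s in F. \<forall>n\<in>{..N}. \<forall>x. norm (d s n x) \<le> e / (C + 1)"
    by (intro eventually_ball_finite ballI small[OF e]) simp
  with family outside show "\<forall>\<^sub>F s in F. dist (u (d s 0)) 0 < e"
  proof eventually_elim
    case (elim s)
    then have "norm (u (d s 0)) \<le> C * (e / (C + 1))"
      by (intro order_boundD[OF C(2)]) auto
    with Ce show ?case by simp
  qed
qed

section \<open>Time derivatives of distributions along curves\<close>

lemma has_vector_derivative_iff_tendsto:
  "(F has_vector_derivative D) (at t) \<longleftrightarrow> ((\<lambda>h. (F (t + h) - F t) /\<^sub>R h) \<longlongrightarrow> D) (at 0)"
proof -
  have "\<forall>\<^sub>F h in at 0. norm ((F (t + h) - F t) /\<^sub>R h - D) = norm (F (t + h) - F t - h *\<^sub>R D) / norm h"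
    using eventually_neq_at_within[of 0]
  proof eventually_elim
    case (elim h)
    then have "(F (t + h) - F t) /\<^sub>R h - D = (F (t + h) - F t - h *\<^sub>R D) /\<^sub>R h"
      by (simp add: scaleR_diff_right)
    then show ?case by (simp add: divide_inverse_commute)
  qed
  from filterlim_cong[OF refl refl this, of "nhds 0"]
  have "((\<lambda>h. norm (F (t + h) - F t - h *\<^sub>R D) / norm h) \<longlongrightarrow> 0) (at 0) \<longleftrightarrow>
      ((\<lambda>h. (F (t + h) - F t) /\<^sub>R h - D) \<longlongrightarrow> 0) (at 0)"
    by (simp only: tendsto_norm_zero_iff)
  then show ?thesis
    unfolding has_vector_derivative_def has_derivative_at
    by (simp only: LIM_zero_iff bounded_linear_scaleR_left simp_thms)
qed

text \<open>The difference quotient minus \<open>E' 0 t\<close> tends to 0 as a test function: at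
  each order n the mean value inequality bounds it by the oscillation of \<open>E' n\<close> near t,
  which is small uniformly in x.\<close>

lemma distribution_curve_has_vector_derivative:
  assumes u: "distribution u" and E: "curve_deriv E E'"
  shows "((\<lambda>t. u (E 0 t)) has_vector_derivative u (E' 0 t)) (at t)"
proof -
  note EE = curve_derivD[OF E]
  note test = test_curve_test_function[OF EE(1)] test_curve_test_function[OF EE(2)]
  obtain R where R: "\<forall>n s x. \<bar>s\<bar> \<le> \<bar>t\<bar> + 1 \<longrightarrow> \<bar>x\<bar> > R \<longrightarrow> E n s x = 0"
    using test_curve_outside[OF EE(1)] by blast
  obtain R' where R': "\<forall>n s x. \<bar>s\<bar> \<le> \<bar>t\<bar> + 1 \<longrightarrow> \<bar>x\<bar> > R' \<longrightarrow> E' n s x = 0"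
    using test_curve_outside[OF EE(2)] by blast
  define d where "d h n x = complex_of_real (1 / h) * (1 * E n (t + h) x + (-1) * E n t x) + (-1) * E' n t x" for h n x
  have fam: "deriv_family (d h)" for h
    using test_curve_vector_derivative[OF EE(1)] test_curve_vector_derivative[OF EE(2)]
    unfolding deriv_family_def d_def by (auto intro!: derivative_eq_intros)
  have near: "\<forall>\<^sub>F h in at 0. \<bar>h\<bar> < \<delta>" if "\<delta> > 0" for \<delta> :: real
    using eventually_at_ball[OF that, of 0 UNIV] by eventually_elim (auto simp: dist_norm)
  have "((\<lambda>h. u (d h 0)) \<longlongrightarrow> 0) (at 0)"
  proof (rule distribution_tendsto_zero[OF u, where R = "max R R'"])
    show "\<forall>\<^sub>F h in at 0. \<forall>x. \<bar>x\<bar> > max R R' \<longrightarrow> d h 0 x = 0"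
      using near[OF zero_less_one] by eventually_elim (use R R' in \<open>auto simp: d_def\<close>)
  next
    fix n and e :: real assume "e > 0"
    obtain \<delta> where \<delta>: "\<delta> > 0" "\<forall>s x. \<bar>s - t\<bar> < \<delta> \<longrightarrow> norm (E' n s x - E' n t x) \<le> e"
      using test_curve_uniformly_continuous[OF EE(2) \<open>e > 0\<close>] by blast
    show "\<forall>\<^sub>F h in at 0. \<forall>x. norm (d h n x) \<le> e"
      using near[OF \<delta>(1)] eventually_neq_at_within[of 0]
    proof eventually_elim
      case (elim h)
      show ?case
      proof
        fix x
        have "norm (E n (t + h) x - E n t x - (t + h - t) *\<^sub>R E' n t x) \<le> norm (t + h - t) * e"
        proof (rule vector_differentiable_bound_linearization[where S = "ball t \<delta>" and f' = "\<lambda>s. E' n s x"])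
          show "closed_segment t (t + h) \<subseteq> ball t \<delta>"
            using elim \<delta>(1) by (intro closed_segment_subset convex_ball) (auto simp: dist_norm)
        qed (use \<delta> elim in \<open>auto intro!: has_vector_derivative_at_within EE(3) simp: dist_norm abs_minus_commute\<close>)
        moreover
        have "d h n x = (1 / h) *\<^sub>R (E n (t + h) x - E n t x - (t + h - t) *\<^sub>R E' n t x)"
          using elim by (simp add: d_def scaleR_conv_of_real field_simps)
        then have "norm (d h n x) = norm (E n (t + h) x - E n t x - (t + h - t) *\<^sub>R E' n t x) / \<bar>h\<bar>"
          by simp
        ultimately show "norm (d h n x) \<le> e" using elim by (simp add: divide_le_eq mult.commute)
      qed
    qed
  qed (simp add: fam)
  \<comment> \<open>Valid for h = 0 too: both quotients are then 0 by the convention for division by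
    0.\<close>
  moreover have "u (d h 0) = (u (E 0 (t + h)) - u (E 0 t)) /\<^sub>R h - u (E' 0 t)" for h
    unfolding d_def
    by (subst distribution_lincomb[OF u], (intro test_functions_lincomb test)+)
      (simp add: distribution_lincomb[OF u test(1) test(1), of 1 _ "-1", simplified] scaleR_conv_of_real divide_simps)
  ultimately have "((\<lambda>h. (u (E 0 (t + h)) - u (E 0 t)) /\<^sub>R h - u (E' 0 t)) \<longlongrightarrow> 0) (at 0)"
    by simp
  then show ?thesis by (simp add: has_vector_derivative_iff_tendsto LIM_zero_cancel)
qed

lemma distribution_curve_isCont:
  assumes u: "distribution u" and E: "test_curve E"
  shows "isCont (\<lambda>t. u (E 0 t)) t"
proof -
  note test = test_curve_test_function[OF E]
  obtain R where R: "\<forall>n s x. \<bar>s\<bar> \<le> \<bar>t\<bar> + 1 \<longrightarrow> \<bar>x\<bar> > R \<longrightarrow> E n s x = 0"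
    using test_curve_outside[OF E] by blast
  define d where "d s n x = 1 * E n s x + (-1) * E n t x" for s n x
  have near: "\<forall>\<^sub>F s in at t. \<bar>s - t\<bar> < \<delta>" if "\<delta> > 0" for \<delta> :: real
    using eventually_at_ball[OF that, of t UNIV] by eventually_elim (auto simp: dist_norm)
  have "((\<lambda>s. u (d s 0)) \<longlongrightarrow> 0) (at t)"
  proof (rule distribution_tendsto_zero[OF u, where R = R])
    have "deriv_family (d s)" for s
      using test_curve_vector_derivative[OF E]
      unfolding deriv_family_def d_def by (auto intro!: derivative_eq_intros)
    then show "\<forall>\<^sub>F s in at t. deriv_family (d s)" by simp
    show "\<forall>\<^sub>F s in at t. \<forall>x. \<bar>x\<bar> > R \<longrightarrow> d s 0 x = 0"
      using near[OF zero_less_one] by eventually_elim (use R in \<open>auto simp: d_def\<close>)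
  next
    fix n and e :: real assume "e > 0"
    then obtain \<delta> where \<delta>: "\<delta> > 0" "\<forall>s x. \<bar>s - t\<bar> < \<delta> \<longrightarrow> norm (E n s x - E n t x) \<le> e"
      using test_curve_uniformly_continuous[OF E] by blast
    show "\<forall>\<^sub>F s in at t. \<forall>x. norm (d s n x) \<le> e"
      using near[OF \<delta>(1)] by eventually_elim (use \<delta> in \<open>simp add: d_def\<close>)
  qed
  moreover have "u (d s 0) = u (E 0 s) - u (E 0 t)" for s
    unfolding d_def using distribution_lincomb[OF u test test, of 1 s "-1" t] by simp
  ultimately show ?thesis by (simp add: isCont_def LIM_zero_cancel)
qed

section \<open>Closure properties of curves and the chain rule\<close>

lemma test_curve_lincomb:
  assumes "test_curve E" "test_curve F"
  shows "test_curve (\<lambda>n t x. a *\<^sub>R E n t x + b *\<^sub>R F n t x)"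
  unfolding test_curve_def
proof (intro conjI allI)
  show "deriv_family (\<lambda>n x. a *\<^sub>R E n t x + b *\<^sub>R F n t x)" for t
    using assms[THEN test_curve_vector_derivative]
    unfolding deriv_family_def by (auto intro!: derivative_eq_intros)
  show "continuous_on UNIV (\<lambda>(t, x). a *\<^sub>R E n t x + b *\<^sub>R F n t x)" for n
    unfolding case_prod_beta
    by (intro continuous_intros test_curve_continuous assms)
  fix T
  obtain R where R: "\<forall>n s x. \<bar>s\<bar> \<le> T \<longrightarrow> \<bar>x\<bar> > R \<longrightarrow> E n s x = 0"
    using test_curve_outside[OF assms(1)] by blast
  obtain S where S: "\<forall>n s x. \<bar>s\<bar> \<le> T \<longrightarrow> \<bar>x\<bar> > S \<longrightarrow> F n s x = 0"
    using test_curve_outside[OF assms(2)] by blast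
  from R S show "\<exists>R. \<forall>t x. \<bar>t\<bar> \<le> T \<longrightarrow> \<bar>x\<bar> > R \<longrightarrow> a *\<^sub>R E 0 t x + b *\<^sub>R F 0 t x = 0"
    by (intro exI[of _ "max R S"]) auto
qed

lemma test_curve_shift:
  assumes "test_curve E"
  shows "test_curve (\<lambda>n. E (n + m))"
  unfolding test_curve_def
proof (intro conjI allI)
  show "deriv_family (\<lambda>n. E (n + m) t)" for t
    using test_curve_vector_derivative[OF assms] unfolding deriv_family_def by simp
  show "continuous_on UNIV (\<lambda>(t, x). E (n + m) t x)" for n
    unfolding case_prod_beta by (intro continuous_intros test_curve_continuous assms)
  show "\<exists>R. \<forall>t x. \<bar>t\<bar> \<le> T \<longrightarrow> \<bar>x\<bar> > R \<longrightarrow> E (0 + m) t x = 0" for T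
    using test_curve_outside[OF assms, of T] by blast
qed

lemma curve_deriv_lincomb:
  assumes "curve_deriv E E'" "curve_deriv F F'"
  shows "curve_deriv (\<lambda>n t x. a *\<^sub>R E n t x + b *\<^sub>R F n t x) (\<lambda>n t x. a *\<^sub>R E' n t x + b *\<^sub>R F' n t x)"
  unfolding curve_deriv_def
  by (intro conjI allI test_curve_lincomb assms[THEN curve_derivD(1)] assms[THEN curve_derivD(2)]
      has_vector_derivative_add bounded_linear.has_vector_derivative[OF bounded_linear_scaleR_right] assms[THEN curve_derivD(3)])

lemma curve_deriv_shift:
  assumes "curve_deriv E E'"
  shows "curve_deriv (\<lambda>n. E (n + m)) (\<lambda>n. E' (n + m))"
  using assms by (simp add: curve_deriv_def test_curve_shift)

text \<open>Partial derivatives in t and x alone give no total derivative; joint continuity of the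
  x-derivative \<open>E (Suc n)\<close> does. It is wrapped as a bounded linear map because its
  continuity is required in that form.\<close>

lemma curve_deriv_chain:
  assumes E: "curve_deriv E E'" and \<gamma>: "(\<gamma> has_real_derivative \<gamma>') (at t)"
  shows "((\<lambda>t. E n t (\<gamma> t)) has_vector_derivative (E' n t (\<gamma> t) + \<gamma>' *\<^sub>R E (Suc n) t (\<gamma> t))) (at t)"
proof -
  note EE = curve_derivD[OF E]
  have "((\<lambda>(t, x). E n t x) has_derivative
      (\<lambda>(s, y). s *\<^sub>R E' n t (\<gamma> t) + blinfun_apply (blinfun_scaleR_left (E (Suc n) t (\<gamma> t))) y))
      (at (t, \<gamma> t) within UNIV \<times> UNIV)"
  proof (rule has_derivative_partialsI[where f = "E n" and x = t and y = "\<gamma> t" and X = UNIV and Y = UNIV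
        and fx = "\<lambda>s. s *\<^sub>R E' n t (\<gamma> t)" and fy = "\<lambda>s x. blinfun_scaleR_left (E (Suc n) s x)"])
    show "((\<lambda>s. E n s (\<gamma> t)) has_derivative (\<lambda>s. s *\<^sub>R E' n t (\<gamma> t))) (at t within UNIV)"
      by (rule EE(3)[unfolded has_vector_derivative_def])
    show "(E n s has_derivative blinfun_apply (blinfun_scaleR_left (E (Suc n) s x))) (at x within UNIV)" for s x
      unfolding blinfun_scaleR_left.rep_eq
      by (rule test_curve_vector_derivative[OF EE(1), unfolded has_vector_derivative_def])
    have "continuous_on UNIV (\<lambda>z. blinfun_scaleR_left (E (Suc n) (fst z) (snd z)))"
      by (intro bounded_linear.continuous_on[OF bounded_linear_blinfun_scaleR_left]
          test_curve_continuous[OF EE(1)] continuous_intros)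
    then show "continuous (at (t, \<gamma> t) within UNIV \<times> UNIV) (\<lambda>(t, x). blinfun_scaleR_left (E (Suc n) t x))"
      by (simp add: case_prod_unfold continuous_on_eq_continuous_at)
  qed simp_all
  then have *: "((\<lambda>(t, x). E n t x) has_derivative
      (\<lambda>(s, y). s *\<^sub>R E' n t (\<gamma> t) + y *\<^sub>R E (Suc n) t (\<gamma> t))) (at (t, \<gamma> t))"
    by (simp add: blinfun_scaleR_left.rep_eq)
  have "((\<lambda>t. (t, \<gamma> t)) has_derivative (\<lambda>h. (h, h * \<gamma>'))) (at t)"
    using \<gamma> by (intro has_derivative_Pair has_derivative_ident) (simp add: has_field_derivative_def mult.commute[of \<gamma>'] mult_commute_abs)
  from has_derivative_compose[OF this *] show ?thesis
    by (simp add: has_vector_derivative_def scaleR_add_right)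
qed

subsection \<open>Averages and the wave operators\<close>

lemma test_curve_chain:
  assumes "test_curve E" "(\<gamma> has_real_derivative \<gamma>') (at z)"
  shows "((\<lambda>z. E n t (\<gamma> z)) has_vector_derivative \<gamma>' *\<^sub>R E (Suc n) t (\<gamma> z)) (at z)"
  using vector_diff_chain_at[OF assms(2)[unfolded has_real_derivative_iff_has_vector_derivative]
      test_curve_vector_derivative[OF assms(1)]]
  by (simp add: o_def)

text \<open>The substitution \<open>y = c t s\<close> turns an integral over \<open>[-c\<bar>t\<bar>, c\<bar>t\<bar>]\<close> into one over a fixed
  interval, with an integrand that is smooth in \<open>t\<close> also at \<open>t = 0\<close>.\<close>

definition average ::
    "real \<Rightarrow> (real \<Rightarrow> real \<Rightarrow> real) \<Rightarrow> (nat \<Rightarrow> real \<Rightarrow> real \<Rightarrow> complex) \<Rightarrow> nat \<Rightarrow> real \<Rightarrow> real \<Rightarrow> complex" where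
  "average c \<kappa> E n t x = integral {-1..1} (\<lambda>s. \<kappa> t s *\<^sub>R E n t (x - c * t * s))"

definition continuous_kernel :: "(real \<Rightarrow> real \<Rightarrow> real) \<Rightarrow> bool" where
  "continuous_kernel \<kappa> \<longleftrightarrow> continuous_on UNIV (\<lambda>(t, s). \<kappa> t s)"

lemma continuous_kernel_compose:
  assumes "continuous_kernel \<kappa>" "continuous_on S f" "continuous_on S g"
  shows "continuous_on S (\<lambda>z. \<kappa> (f z) (g z))"
proof -
  have "continuous_on UNIV (\<lambda>(t, s). \<kappa> t s)" using assms(1) by (simp add: continuous_kernel_def)
  from continuous_on_compose2[OF this continuous_on_Pair[OF assms(2,3)]] show ?thesis by simp
qed

lemma average_integrable:
  assumes "continuous_kernel \<kappa>" "test_curve E"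
  shows "(\<lambda>s. \<kappa> t s *\<^sub>R E n t (x - c * t * s)) integrable_on {-1..1}"
  by (intro integrable_continuous_real continuous_intros continuous_kernel_compose[OF assms(1)]
      test_curve_continuous[OF assms(2)])

text \<open>Finite speed of propagation: for s in [-1, 1] the point x - c t s lies within |c t| of
  x.\<close>

lemma average_outside:
  assumes "\<And>x. \<bar>x\<bar> > R \<Longrightarrow> E n t x = 0" "\<bar>x\<bar> > R + \<bar>c * t\<bar>"
  shows "average c \<kappa> E n t x = 0"
proof -
  have "\<kappa> t s *\<^sub>R E n t (x - c * t * s) = 0" if "s \<in> {-1..1}" for s
  proof -
    have "\<bar>c * t * s\<bar> \<le> \<bar>c * t\<bar>" using that by (auto simp: abs_mult intro!: mult_right_le_one_le)
    then have "\<bar>x - c * t * s\<bar> > R" using assms(2) by linarith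
    then show ?thesis using assms(1) by simp
  qed
  then have "average c \<kappa> E n t x = integral {-1..1::real} (\<lambda>s. 0)"
    unfolding average_def by (rule Henstock_Kurzweil_Integration.integral_cong)
  then show ?thesis by simp
qed

lemma average_deriv_family:
  assumes \<kappa>: "continuous_kernel \<kappa>" and E: "test_curve E"
  shows "deriv_family (\<lambda>n. average c \<kappa> E n t)"
  unfolding deriv_family_def
proof (intro allI)
  fix n x
  have "((\<lambda>x. integral (cbox (-1) 1) (\<lambda>s. \<kappa> t s *\<^sub>R E n t (x - c * t * s))) has_vector_derivative
      integral (cbox (-1) 1) (\<lambda>s. \<kappa> t s *\<^sub>R E (Suc n) t (x - c * t * s))) (at x within UNIV)"
  proof (rule leibniz_rule_vector_derivative)
    show "((\<lambda>x. \<kappa> t s *\<^sub>R E n t (x - c * t * s)) has_vector_derivative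
        \<kappa> t s *\<^sub>R E (Suc n) t (x - c * t * s)) (at x within UNIV)" for x s
    proof -
      have "((\<lambda>x. E n t (x - c * t * s)) has_vector_derivative E (Suc n) t (x - c * t * s)) (at x)"
        by (rule test_curve_chain[OF E, where \<gamma>' = 1, simplified]) (auto intro!: derivative_eq_intros)
      then show ?thesis
        using bounded_linear.has_vector_derivative[OF bounded_linear_scaleR_right] by auto
    qed
    show "continuous_on (UNIV \<times> cbox (-1) 1) (\<lambda>(x, s). \<kappa> t s *\<^sub>R E (Suc n) t (x - c * t * s))"
      unfolding case_prod_unfold
      by (intro continuous_intros continuous_kernel_compose[OF \<kappa>] test_curve_continuous[OF E])
  qed (use average_integrable[OF \<kappa> E] in \<open>simp_all add: box_real\<close>)
  then show "(average c \<kappa> E n t has_vector_derivative average c \<kappa> E (Suc n) t x) (at x)"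
    unfolding average_def[abs_def] box_real by simp
qed

lemma average_test_curve:
  assumes \<kappa>: "continuous_kernel \<kappa>" and E: "test_curve E"
  shows "test_curve (average c \<kappa> E)"
  unfolding test_curve_def
proof (intro conjI allI average_deriv_family assms)
  fix n
  have "continuous_on (UNIV \<times> cbox (-1) 1) (\<lambda>(z, s). \<kappa> (fst z) s *\<^sub>R E n (fst z) (snd z - c * fst z * s))"
    unfolding case_prod_unfold
    by (intro continuous_intros continuous_kernel_compose[OF \<kappa>] test_curve_continuous[OF E])
  from integral_continuous_on_param[OF this]
  show "continuous_on UNIV (\<lambda>(t, x). average c \<kappa> E n t x)"
    by (simp add: average_def case_prod_unfold)
next
  fix T
  obtain R where R: "\<forall>n t x. \<bar>t\<bar> \<le> T \<longrightarrow> \<bar>x\<bar> > R \<longrightarrow> E n t x = 0"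
    using test_curve_outside[OF E] by blast
  show "\<exists>R. \<forall>t x. \<bar>t\<bar> \<le> T \<longrightarrow> \<bar>x\<bar> > R \<longrightarrow> average c \<kappa> E 0 t x = 0"
  proof (intro exI[of _ "R + \<bar>c\<bar> * T"] allI impI)
    fix t x :: real assume t: "\<bar>t\<bar> \<le> T" and x: "\<bar>x\<bar> > R + \<bar>c\<bar> * T"
    have "\<bar>c * t\<bar> \<le> \<bar>c\<bar> * T" using t by (simp add: abs_mult mult_left_mono)
    then show "average c \<kappa> E 0 t x = 0" using R t x by (intro average_outside[of R]) auto
  qed
qed

text \<open>The interval [-1, 1] does not move with t, so differentiation under the integral leaves
  no boundary terms; the factor c s comes from the moving argument x - c t s.\<close>

lemma average_has_vector_derivative:
  assumes \<kappa>: "continuous_kernel \<kappa>" and \<kappa>': "continuous_kernel \<kappa>'"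
    and d\<kappa>: "\<And>t s. ((\<lambda>t. \<kappa> t s) has_real_derivative \<kappa>' t s) (at t)"
    and E: "curve_deriv E E'"
  shows "((\<lambda>t. average c \<kappa> E n t x) has_vector_derivative
    integral {-1..1} (\<lambda>s. \<kappa> t s *\<^sub>R (E' n t (x - c * t * s) - (c * s) *\<^sub>R E (Suc n) t (x - c * t * s))
      + \<kappa>' t s *\<^sub>R E n t (x - c * t * s))) (at t)"
proof -
  note EE = curve_derivD[OF E]
  have "((\<lambda>t. integral (cbox (-1) 1) (\<lambda>s. \<kappa> t s *\<^sub>R E n t (x - c * t * s))) has_vector_derivative
      integral (cbox (-1) 1) (\<lambda>s. \<kappa> t s *\<^sub>R (E' n t (x - c * t * s) - (c * s) *\<^sub>R E (Suc n) t (x - c * t * s))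
      + \<kappa>' t s *\<^sub>R E n t (x - c * t * s))) (at t within UNIV)"
  proof (rule leibniz_rule_vector_derivative)
    fix t s :: real
    have "((\<lambda>t. E n t (x - c * t * s)) has_vector_derivative
        E' n t (x - c * t * s) + (- (c * s)) *\<^sub>R E (Suc n) t (x - c * t * s)) (at t)"
      by (rule curve_deriv_chain[OF E]) (auto intro!: derivative_eq_intros)
    from has_vector_derivative_scaleR[OF d\<kappa> this]
    show "((\<lambda>t. \<kappa> t s *\<^sub>R E n t (x - c * t * s)) has_vector_derivative
        \<kappa> t s *\<^sub>R (E' n t (x - c * t * s) - (c * s) *\<^sub>R E (Suc n) t (x - c * t * s))
        + \<kappa>' t s *\<^sub>R E n t (x - c * t * s)) (at t within UNIV)" by simp
  next
    show "continuous_on (UNIV \<times> cbox (-1) 1) (\<lambda>(t, s).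
        \<kappa> t s *\<^sub>R (E' n t (x - c * t * s) - (c * s) *\<^sub>R E (Suc n) t (x - c * t * s))
        + \<kappa>' t s *\<^sub>R E n t (x - c * t * s))"
      unfolding case_prod_unfold
      by (intro continuous_intros continuous_kernel_compose[OF \<kappa>] continuous_kernel_compose[OF \<kappa>']
          test_curve_continuous[OF EE(1)] test_curve_continuous[OF EE(2)])
  qed (use average_integrable[OF \<kappa> EE(1)] in \<open>simp_all add: box_real\<close>)
  then show ?thesis by (simp add: average_def box_real)
qed

lemma norm_average_le:
  assumes "continuous_kernel \<kappa>" "test_curve E"
    and "\<And>s. s \<in> {-1..1} \<Longrightarrow> \<bar>\<kappa> t s\<bar> \<le> M" "\<And>y. norm (E n t y) \<le> B" "0 \<le> M"
  shows "norm (average c \<kappa> E n t x) \<le> 2 * M * B"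
proof -
  have "norm (integral {-1..1} (\<lambda>s. \<kappa> t s *\<^sub>R E n t (x - c * t * s))) \<le> (M * B) * (1 - (-1))"
  proof (rule integral_bound)
    fix s :: real assume "s \<in> {-1..1}"
    then show "norm (\<kappa> t s *\<^sub>R E n t (x - c * t * s)) \<le> M * B"
      using assms(3-5) by (auto intro!: mult_mono)
  qed (auto intro!: continuous_intros continuous_kernel_compose[OF assms(1)] test_curve_continuous[OF assms(2)])
  then show ?thesis by (simp add: average_def mult_ac)
qed

text \<open>\<open>bessel_series i\<close> is the \<open>i\<close>-th derivative of the entire function \<open>J\<close> with
  \<open>I\<^sub>0(z) = J(z\<^sup>2 / 4)\<close>; this removes the square root from \<open>\<psi>\<close>.\<close>

definition bessel_series :: "nat \<Rightarrow> real \<Rightarrow> real" where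
  "bessel_series i w = (\<Sum>n. (diffs ^^ i) (\<lambda>n. 1 / (fact n)\<^sup>2) n * w ^ n)"

text \<open>The coefficients 1 / (n!)^2 are dominated by those of exp, and termwise differentiation
  preserves convergence everywhere.\<close>

lemma bessel_series_summable: "summable (\<lambda>n. (diffs ^^ i) (\<lambda>n. 1 / (fact n)\<^sup>2) n * (w::real) ^ n)"
proof (induction i arbitrary: w)
  case 0
  have "summable (\<lambda>n. inverse (fact n) * \<bar>w\<bar> ^ n)" by (rule summable_exp)
  moreover have "norm (1 / (fact n)\<^sup>2 * w ^ n) \<le> inverse (fact n) * \<bar>w\<bar> ^ n" for n
  proof -
    have "1 / (fact n)\<^sup>2 \<le> inverse (fact n :: real)"
      by (simp add: field_simps power2_eq_square)
    from mult_right_mono[OF this, of "\<bar>w\<bar> ^ n"] show ?thesis by (simp add: norm_mult power_abs)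
  qed
  ultimately show ?case by (simp add: summable_comparison_test')
next
  case (Suc i)
  then show ?case using termdiff_converges_all[of "(diffs ^^ i) (\<lambda>n. 1 / (fact n)\<^sup>2)" w] by simp
qed

lemma bessel_series_deriv: "(bessel_series i has_real_derivative bessel_series (Suc i) w) (at w)"
  using termdiffs_strong_converges_everywhere[OF bessel_series_summable[of i], of w]
  by (simp add: bessel_series_def[abs_def])

lemma continuous_on_bessel_series [continuous_intros]:
  assumes "continuous_on S f"
  shows "continuous_on S (\<lambda>z. bessel_series i (f z))"
proof -
  have "continuous_on UNIV (bessel_series i)"
    by (intro continuous_at_imp_continuous_on ballI DERIV_isCont[OF bessel_series_deriv])
  then show ?thesis using assms by (rule continuous_on_compose2) simp
qed

lemma bessel_series_0 [simp]: "bessel_series 0 0 = 1" "bessel_series (Suc 0) 0 = 1"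
  unfolding bessel_series_def powser_zero by (simp_all add: diffs_def)

text \<open>Bessel's equation z^2 I_0'' + z I_0' = z^2 I_0 in the variable w = z^2 / 4. On
  coefficients it reads (n + 1)^2 / ((n + 1)!)^2 = 1 / (n!)^2.\<close>

lemma bessel_series_ode:
  "bessel_series (Suc 0) w + w * bessel_series (Suc (Suc 0)) w = bessel_series 0 w"
proof -
  let ?c = "\<lambda>n. 1 / (fact n)\<^sup>2 :: real"
  have c: "(1 + real n) * diffs ?c n = ?c n" for n
    by (simp add: diffs_def fact_Suc power_mult_distrib power2_eq_square del: of_nat_Suc) (simp add: add_ac)
  have 1: "(\<lambda>n. diffs ?c n * w ^ n) sums bessel_series (Suc 0) w"
    using summable_sums[OF bessel_series_summable[of 1 w]] by (simp add: bessel_series_def)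
  have "(\<lambda>n. real n * diffs ?c n * w ^ (n - Suc 0)) sums bessel_series (Suc (Suc 0)) w"
    using diffs_equiv[of "diffs ?c" w] bessel_series_summable[of 2 w]
    by (simp add: bessel_series_def numeral_2_eq_2)
  \<comment> \<open>Multiplying by w restores the exponent n; at n = 0, where n - 1 is truncated,
    the factor \<open>real n\<close> vanishes.\<close>
  from sums_mult[OF this, of w]
  have 2: "(\<lambda>n. real n * diffs ?c n * w ^ n) sums (w * bessel_series (Suc (Suc 0)) w)"
    by (rule back_subst[of "\<lambda>f. f sums _"]) (auto simp: fun_eq_iff power_eq_if)
  have "diffs ?c n * w ^ n + real n * diffs ?c n * w ^ n = ?c n * w ^ n" for n
  proof -
    have "(1 + real n) * diffs ?c n * w ^ n = ?c n * w ^ n" by (simp only: c)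
    then show ?thesis by (simp only: distrib_right mult_1_left)
  qed
  with sums_add[OF 1 2]
  have "(\<lambda>n. ?c n * w ^ n) sums (bessel_series (Suc 0) w + w * bessel_series (Suc (Suc 0)) w)"
    by (simp only:)
  then show ?thesis by (simp add: bessel_series_def sums_iff)
qed

text \<open>With \<open>a = \<alpha> c = k / 4\<close>, these are the kernels of \<open>\<psi>\<close> and of the regular part of \<open>\<psi>\<^sub>t\<close>
  after the substitution; the Jacobian \<open>c\<bar>t\<bar>\<close> is included.\<close>

definition wave_kernel :: "real \<Rightarrow> real \<Rightarrow> real \<Rightarrow> real" where
  "wave_kernel a t s = t / 2 * bessel_series 0 (a\<^sup>2 * t\<^sup>2 * (1 - s\<^sup>2))"

definition wave_kernel_t :: "real \<Rightarrow> real \<Rightarrow> real \<Rightarrow> real" where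
  "wave_kernel_t a t s = a\<^sup>2 * t\<^sup>2 * bessel_series (Suc 0) (a\<^sup>2 * t\<^sup>2 * (1 - s\<^sup>2))"

lemma continuous_wave_kernel: "continuous_kernel (wave_kernel a)"
  unfolding continuous_kernel_def wave_kernel_def case_prod_unfold by (intro continuous_intros) simp_all

lemma continuous_wave_kernel_t: "continuous_kernel (wave_kernel_t a)"
  unfolding continuous_kernel_def wave_kernel_t_def case_prod_unfold by (intro continuous_intros)

text \<open>Integration by parts in s will remove the term J / 2 and the part with s^2, leaving
  exactly \<open>wave_kernel_t\<close>.\<close>

lemma wave_kernel_deriv:
  "((\<lambda>t. wave_kernel a t s) has_real_derivative
     bessel_series 0 (a\<^sup>2 * t\<^sup>2 * (1 - s\<^sup>2)) / 2 + (1 - s\<^sup>2) * wave_kernel_t a t s) (at t)"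
  unfolding wave_kernel_def wave_kernel_t_def
  by (rule derivative_eq_intros DERIV_chain2[OF bessel_series_deriv] refl zero_neq_numeral[symmetric])+
    (simp add: power2_eq_square algebra_simps)

text \<open>Here Bessel's equation enters: with w = a^2 t^2 (1 - s^2) the chain rule gives 2 a^2 t
  (J'(w) + w J''(w)) = 2 a^2 t J(w). The factor 4 a^2 becomes the zeroth-order coefficient k^2 /
  4.\<close>

lemma wave_kernel_t_deriv:
  "((\<lambda>t. wave_kernel_t a t s) has_real_derivative 4 * a\<^sup>2 * wave_kernel a t s) (at t)"
proof -
  let ?w = "a\<^sup>2 * t\<^sup>2 * (1 - s\<^sup>2)"
  have "((\<lambda>t. wave_kernel_t a t s) has_real_derivative
      2 * a\<^sup>2 * t * (bessel_series (Suc 0) ?w + ?w * bessel_series (Suc (Suc 0)) ?w)) (at t)"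
    unfolding wave_kernel_t_def
    by (rule derivative_eq_intros DERIV_chain2[OF bessel_series_deriv] refl zero_neq_numeral[symmetric])+
      (simp add: power2_eq_square algebra_simps)
  then show ?thesis unfolding bessel_series_ode by (simp add: wave_kernel_def mult_ac)
qed

section \<open>The operators W and V on curves and their time derivatives\<close>

definition wave_op ::
    "real \<Rightarrow> real \<Rightarrow> (nat \<Rightarrow> real \<Rightarrow> real \<Rightarrow> complex) \<Rightarrow> nat \<Rightarrow> real \<Rightarrow> real \<Rightarrow> complex" where
  "wave_op c a = average c (wave_kernel a)"

text \<open>The two half translates are the Dirac masses of psi_t, the average is its regular
  part.\<close>

definition wave_op_t ::
    "real \<Rightarrow> real \<Rightarrow> (nat \<Rightarrow> real \<Rightarrow> real \<Rightarrow> complex) \<Rightarrow> nat \<Rightarrow> real \<Rightarrow> real \<Rightarrow> complex" where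
  "wave_op_t c a E n t x =
     (1/2) *\<^sub>R E n t (x - c * t) + (1/2) *\<^sub>R E n t (x + c * t) + average c (wave_kernel_t a) E n t x"

lemma test_curve_translate:
  assumes E: "test_curve E"
  shows "test_curve (\<lambda>n t x. E n t (x + c * t))"
  unfolding test_curve_def
proof (intro conjI allI)
  show "deriv_family (\<lambda>n x. E n t (x + c * t))" for t
    unfolding deriv_family_def
  proof (intro allI)
    show "((\<lambda>x. E n t (x + c * t)) has_vector_derivative E (Suc n) t (x + c * t)) (at x)" for n x
      by (rule test_curve_chain[OF E, where \<gamma>' = 1, simplified]) (auto intro!: derivative_eq_intros)
  qed
  show "continuous_on UNIV (\<lambda>(t, x). E n t (x + c * t))" for n
    unfolding case_prod_unfold by (intro continuous_intros test_curve_continuous[OF E])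
  fix T
  obtain R where R: "\<forall>n t x. \<bar>t\<bar> \<le> T \<longrightarrow> \<bar>x\<bar> > R \<longrightarrow> E n t x = 0"
    using test_curve_outside[OF E] by blast
  show "\<exists>R. \<forall>t x. \<bar>t\<bar> \<le> T \<longrightarrow> \<bar>x\<bar> > R \<longrightarrow> E 0 t (x + c * t) = 0"
  proof (intro exI[of _ "R + \<bar>c\<bar> * T"] allI impI)
    fix t x :: real assume t: "\<bar>t\<bar> \<le> T" and x: "\<bar>x\<bar> > R + \<bar>c\<bar> * T"
    have "\<bar>c * t\<bar> \<le> \<bar>c\<bar> * T" using t by (simp add: abs_mult mult_left_mono)
    then have "\<bar>x + c * t\<bar> > R" using x by linarith
    then show "E 0 t (x + c * t) = 0" using R t by simp
  qed
qed

lemma test_curve_wave_op: "test_curve E \<Longrightarrow> test_curve (wave_op c a E)"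
  by (simp add: wave_op_def average_test_curve continuous_wave_kernel)

lemma test_curve_wave_op_t:
  assumes "test_curve E"
  shows "test_curve (wave_op_t c a E)"
proof -
  have "test_curve (\<lambda>n t x. (1/2) *\<^sub>R E n t (x + (-c) * t) + (1/2) *\<^sub>R E n t (x + c * t))"
    by (intro test_curve_lincomb test_curve_translate assms)
  from test_curve_lincomb[OF this average_test_curve[OF continuous_wave_kernel_t assms, of c a], of 1 1]
  show ?thesis by (simp add: wave_op_t_def[abs_def])
qed

lemma curve_translate_has_vector_derivative:
  assumes "test_curve E"
  shows "((\<lambda>s. E n t (x - c * t * s)) has_vector_derivative (- (c * t)) *\<^sub>R E (Suc n) t (x - c * t * s)) (at s)"
  by (rule test_curve_chain[OF assms]) (auto intro!: derivative_eq_intros)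

lemma integral_eqI_of_derivative:
  fixes f :: "real \<Rightarrow> complex"
  assumes "\<And>s. (G has_vector_derivative f s - g s) (at s)"
    and "f integrable_on {-1..1}" "g integrable_on {-1..1}"
  shows "integral {-1..1} f = G 1 - G (-1) + integral {-1..1} g"
proof -
  have "((\<lambda>s. f s - g s) has_integral (G 1 - G (-1))) {-1..1}"
    by (rule fundamental_theorem_of_calculus) (use assms(1) in \<open>auto intro: has_vector_derivative_at_within\<close>)
  then have "integral {-1..1} (\<lambda>s. f s - g s) = G 1 - G (-1)" by (rule integral_unique)
  then show ?thesis using integral_diff[OF assms(2,3)] by (simp add: algebra_simps)
qed

text \<open>The factors \<open>1\<close> give the sum the shape of \<open>test_curve_lincomb\<close>.\<close>

lemma curve_deriv_wave_op:
  assumes E: "curve_deriv E E'"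
  shows "curve_deriv (wave_op c a E) (\<lambda>n t x. 1 *\<^sub>R wave_op_t c a E n t x + 1 *\<^sub>R wave_op c a E' n t x)"
  unfolding curve_deriv_def
proof (intro conjI allI)
  note EE = curve_derivD[OF E]
  show "test_curve (wave_op c a E)" by (rule test_curve_wave_op[OF EE(1)])
  show "test_curve (\<lambda>n t x. 1 *\<^sub>R wave_op_t c a E n t x + 1 *\<^sub>R wave_op c a E' n t x)"
    by (intro test_curve_lincomb test_curve_wave_op test_curve_wave_op_t EE)
  fix n t x
  let ?w = "\<lambda>s. a\<^sup>2 * t\<^sup>2 * (1 - s\<^sup>2)"
  let ?dk = "\<lambda>t s. bessel_series 0 (a\<^sup>2 * t\<^sup>2 * (1 - s\<^sup>2)) / 2 + (1 - s\<^sup>2) * wave_kernel_t a t s"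
  let ?e = "\<lambda>n s. E n t (x - c * t * s)"
  let ?e' = "\<lambda>s. E' n t (x - c * t * s)"
  let ?f = "\<lambda>s. wave_kernel a t s *\<^sub>R (?e' s - (c * s) *\<^sub>R ?e (Suc n) s) + ?dk t s *\<^sub>R ?e n s"
  let ?g = "\<lambda>s. wave_kernel_t a t s *\<^sub>R ?e n s + wave_kernel a t s *\<^sub>R ?e' s"
  \<comment> \<open>integration by parts in \<open>s\<close>: the integrands differ by the total derivative of \<open>?G\<close>\<close>
  let ?G = "\<lambda>s. (s / 2 * bessel_series 0 (?w s)) *\<^sub>R ?e n s"
  have dk: "continuous_kernel ?dk"
    using continuous_wave_kernel_t[of a] unfolding continuous_kernel_def case_prod_unfold
    by (intro continuous_intros) simp_all
  have "((\<lambda>t. wave_op c a E n t x) has_vector_derivative integral {-1..1} ?f) (at t)"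
    unfolding wave_op_def
    by (rule average_has_vector_derivative[OF continuous_wave_kernel dk wave_kernel_deriv E])
  also have "integral {-1..1} ?f = ?G 1 - ?G (-1) + integral {-1..1} ?g"
  proof (rule integral_eqI_of_derivative)
    fix s
    have "((\<lambda>s. s / 2 * bessel_series 0 (?w s)) has_real_derivative
        bessel_series 0 (?w s) / 2 - s\<^sup>2 * wave_kernel_t a t s) (at s)"
      unfolding wave_kernel_t_def
      by (rule derivative_eq_intros DERIV_chain2[OF bessel_series_deriv] refl zero_neq_numeral[symmetric])+
        (simp add: power2_eq_square algebra_simps)
    from has_vector_derivative_scaleR[OF this curve_translate_has_vector_derivative[OF EE(1)], of n t x c]
    show "(?G has_vector_derivative ?f s - ?g s) (at s)"
      by (rule back_subst[of "\<lambda>d. (_ has_vector_derivative d) _"])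
        (simp add: wave_kernel_def scaleR_conv_of_real field_simps power2_eq_square)
  next
    show "?f integrable_on {-1..1}"
      by (intro integrable_continuous_real continuous_intros continuous_kernel_compose[OF dk]
          continuous_kernel_compose[OF continuous_wave_kernel] test_curve_continuous[OF EE(1)] test_curve_continuous[OF EE(2)])
    show "?g integrable_on {-1..1}"
      by (intro integrable_add average_integrable continuous_wave_kernel continuous_wave_kernel_t EE)
  qed
  \<comment> \<open>At s = 1 and s = -1 the Bessel factor is J(0) = 1, so the boundary terms are the
    two half translates in \<open>wave_op_t\<close>.\<close>
  also have "\<dots> = 1 *\<^sub>R wave_op_t c a E n t x + 1 *\<^sub>R wave_op c a E' n t x"
    using integral_add[OF average_integrable[OF continuous_wave_kernel_t EE(1), of a t n x c]
        average_integrable[OF continuous_wave_kernel EE(2), of a t n x c]]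
    by (simp add: wave_op_t_def wave_op_def average_def)
  finally show "((\<lambda>t. wave_op c a E n t x) has_vector_derivative
      1 *\<^sub>R wave_op_t c a E n t x + 1 *\<^sub>R wave_op c a E' n t x) (at t)" .
qed

text \<open>Since \<open>4 a\<^sup>2 = k\<^sup>2 / 4\<close>, this is the right-hand side \<open>c\<^sup>2 v\<^sub>x\<^sub>x + (k\<^sup>2 / 4) v\<close> of the equation.\<close>

definition klein_gordon ::
    "real \<Rightarrow> real \<Rightarrow> (nat \<Rightarrow> real \<Rightarrow> real \<Rightarrow> complex) \<Rightarrow> nat \<Rightarrow> real \<Rightarrow> real \<Rightarrow> complex" where
  "klein_gordon c a E n t x = c\<^sup>2 *\<^sub>R E (n + 2) t x + (4 * a\<^sup>2) *\<^sub>R E n t x"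

text \<open>Differentiating the two translates leaves terms of order n + 1 at x - c t and x + c t
  with coefficients -c/2 and c/2. The boundary terms of the integration by parts are their
  negatives, so only averages survive.\<close>

lemma curve_deriv_wave_op_t:
  assumes E: "curve_deriv E E'"
  shows "curve_deriv (wave_op_t c a E)
    (\<lambda>n t x. 1 *\<^sub>R wave_op c a (klein_gordon c a E) n t x + 1 *\<^sub>R wave_op_t c a E' n t x)"
  unfolding curve_deriv_def
proof (intro conjI allI)
  note EE = curve_derivD[OF E]
  have L: "test_curve (klein_gordon c a E)"
    unfolding klein_gordon_def[abs_def] by (intro test_curve_lincomb EE(1) test_curve_shift)
  show "test_curve (wave_op_t c a E)" by (rule test_curve_wave_op_t[OF EE(1)])
  show "test_curve (\<lambda>n t x. 1 *\<^sub>R wave_op c a (klein_gordon c a E) n t x + 1 *\<^sub>R wave_op_t c a E' n t x)"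
    by (intro test_curve_lincomb test_curve_wave_op test_curve_wave_op_t L EE)
  fix n t x
  let ?w = "\<lambda>s. a\<^sup>2 * t\<^sup>2 * (1 - s\<^sup>2)"
  let ?dk = "\<lambda>t s. 4 * a\<^sup>2 * wave_kernel a t s"
  let ?e = "\<lambda>n s. E n t (x - c * t * s)"
  let ?e' = "\<lambda>s. E' n t (x - c * t * s)"
  let ?f = "\<lambda>s. wave_kernel_t a t s *\<^sub>R (?e' s - (c * s) *\<^sub>R ?e (Suc n) s) + ?dk t s *\<^sub>R ?e n s"
  let ?g = "\<lambda>s. wave_kernel a t s *\<^sub>R klein_gordon c a E n t (x - c * t * s) + wave_kernel_t a t s *\<^sub>R ?e' s"
  \<comment> \<open>Differentiating the Bessel factor gives the term of \<open>?f\<close> with order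
    n + 1; differentiating the translate gives -c^2 \<open>wave_kernel\<close> times order n + 2,
    matching the spatial part of \<open>klein_gordon\<close>.\<close>
  let ?G = "\<lambda>s. (c / 2 * bessel_series 0 (?w s)) *\<^sub>R ?e (Suc n) s"
  have dk: "continuous_kernel ?dk"
    using continuous_wave_kernel[of a] unfolding continuous_kernel_def case_prod_unfold
    by (intro continuous_intros)
  have d1: "((\<lambda>t. E n t (x - c * t)) has_vector_derivative
      E' n t (x - c * t) + (- c) *\<^sub>R E (Suc n) t (x - c * t)) (at t)"
    by (rule curve_deriv_chain[OF E]) (auto intro!: derivative_eq_intros)
  have d2: "((\<lambda>t. E n t (x + c * t)) has_vector_derivative
      E' n t (x + c * t) + c *\<^sub>R E (Suc n) t (x + c * t)) (at t)"
    by (rule curve_deriv_chain[OF E]) (auto intro!: derivative_eq_intros)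
  note half = bounded_linear.has_vector_derivative[OF bounded_linear_scaleR_right[of "1/2"]]
  have "((\<lambda>t. wave_op_t c a E n t x) has_vector_derivative
      (1/2) *\<^sub>R (E' n t (x - c * t) + (- c) *\<^sub>R E (Suc n) t (x - c * t)) +
      (1/2) *\<^sub>R (E' n t (x + c * t) + c *\<^sub>R E (Suc n) t (x + c * t)) + integral {-1..1} ?f) (at t)"
    unfolding wave_op_t_def
    by (intro has_vector_derivative_add half d1 d2
        average_has_vector_derivative[OF continuous_wave_kernel_t dk wave_kernel_t_deriv E])
  also have "integral {-1..1} ?f = ?G 1 - ?G (-1) + integral {-1..1} ?g"
  proof (rule integral_eqI_of_derivative)
    fix s
    have "((\<lambda>s. c / 2 * bessel_series 0 (?w s)) has_real_derivative - (c * s * wave_kernel_t a t s)) (at s)"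
      unfolding wave_kernel_t_def
      by (rule derivative_eq_intros DERIV_chain2[OF bessel_series_deriv] refl zero_neq_numeral[symmetric])+
        (simp add: power2_eq_square algebra_simps)
    from has_vector_derivative_scaleR[OF this curve_translate_has_vector_derivative[OF EE(1)], of "Suc n" t x c]
    show "(?G has_vector_derivative ?f s - ?g s) (at s)"
      by (rule back_subst[of "\<lambda>d. (_ has_vector_derivative d) _"])
        (simp add: wave_kernel_def klein_gordon_def scaleR_conv_of_real algebra_simps power2_eq_square)
  next
    show "?f integrable_on {-1..1}"
      by (intro integrable_continuous_real continuous_intros continuous_kernel_compose[OF continuous_wave_kernel]
          continuous_kernel_compose[OF continuous_wave_kernel_t] test_curve_continuous[OF EE(1)] test_curve_continuous[OF EE(2)])
    show "?g integrable_on {-1..1}"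
      by (intro integrable_add average_integrable continuous_wave_kernel continuous_wave_kernel_t L EE)
  qed
  also have "integral {-1..1} ?g = wave_op c a (klein_gordon c a E) n t x + average c (wave_kernel_t a) E' n t x"
    using integral_add[OF average_integrable[OF continuous_wave_kernel L, of a t n x c]
        average_integrable[OF continuous_wave_kernel_t EE(2), of a t n x c]]
    by (simp add: wave_op_def average_def)
  also have "(1/2) *\<^sub>R (E' n t (x - c * t) + (- c) *\<^sub>R E (Suc n) t (x - c * t)) +
      (1/2) *\<^sub>R (E' n t (x + c * t) + c *\<^sub>R E (Suc n) t (x + c * t)) + (?G 1 - ?G (-1) +
      (wave_op c a (klein_gordon c a E) n t x + average c (wave_kernel_t a) E' n t x)) =
      1 *\<^sub>R wave_op c a (klein_gordon c a E) n t x + 1 *\<^sub>R wave_op_t c a E' n t x"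
    by (simp add: wave_op_t_def algebra_simps)
  finally show "((\<lambda>t. wave_op_t c a E n t x) has_vector_derivative
      1 *\<^sub>R wave_op c a (klein_gordon c a E) n t x + 1 *\<^sub>R wave_op_t c a E' n t x) (at t)" .
qed

subsection \<open>Convolution with \<open>\<psi>\<close> and \<open>\<psi>\<^sub>t\<close>\<close>

lemma bessel_I0_eq: "bessel_I0 z = bessel_series 0 (z\<^sup>2 / 4)"
proof -
  have "(z / 2) ^ (2 * m) / (fact m)\<^sup>2 = (diffs ^^ 0) (\<lambda>n. 1 / (fact n)\<^sup>2) m * (z\<^sup>2 / 4) ^ m" for m
    by (simp add: power_mult power_divide)
  then show ?thesis by (simp only: bessel_I0_def bessel_series_def)
qed

text \<open>In I_0'(2 alpha z) = alpha z J'(alpha^2 z^2) the factor z cancels, and the value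
  prescribed at z = 0 fits because J'(0) = 1.\<close>

lemma bessel_quot_eq: "bessel_quot \<alpha> z = \<alpha> * bessel_series (Suc 0) (\<alpha>\<^sup>2 * z\<^sup>2)"
proof (cases "z = 0")
  case False
  have "(bessel_I0 has_real_derivative bessel_series (Suc 0) (w\<^sup>2 / 4) * (w / 2)) (at w)" for w
    unfolding bessel_I0_eq[abs_def]
    by (rule DERIV_chain2[OF bessel_series_deriv]) (auto intro!: derivative_eq_intros)
  then have "deriv bessel_I0 (2 * \<alpha> * z) = bessel_series (Suc 0) ((2 * \<alpha> * z)\<^sup>2 / 4) * (2 * \<alpha> * z / 2)"
    by (rule DERIV_imp_deriv)
  with False show ?thesis by (simp add: bessel_quot_def power_mult_distrib)
qed (simp add: bessel_quot_def)

text \<open>The substitution y = m s, where m may be negative, followed by the passage from the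
  Lebesgue integral on the line to the gauge integral on [-1, 1] used in
  \<open>average\<close>.\<close>

lemma lborel_integral_dilated_kernel:
  fixes \<phi> :: "real \<Rightarrow> complex"
  assumes "m \<noteq> 0" and \<phi>: "continuous_on UNIV \<phi>" and \<kappa>: "continuous_on {-1..1} \<kappa>"
    and F: "\<And>s. F (m * s) * \<bar>m\<bar> = indicator {-1..1} s * \<kappa> s"
  shows "(LINT y|lborel. of_real (F y) * \<phi> (x - y)) = integral {-1..1} (\<lambda>s. \<kappa> s *\<^sub>R \<phi> (x - m * s))"
proof -
  have "(LINT y|lborel. of_real (F y) * \<phi> (x - y)) = (LINT s|lborel. \<bar>m\<bar> *\<^sub>R (of_real (F (m * s)) * \<phi> (x - m * s)))"
    using lborel_integral_real_affine[OF \<open>m \<noteq> 0\<close>, of "\<lambda>y. of_real (F y) * \<phi> (x - y)" 0] by simp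
  also have "(\<lambda>s. \<bar>m\<bar> *\<^sub>R (of_real (F (m * s)) * \<phi> (x - m * s))) =
      (\<lambda>s. indicator {-1..1} s *\<^sub>R (\<kappa> s *\<^sub>R \<phi> (x - m * s)))"
  proof
    fix s
    have "\<bar>m\<bar> *\<^sub>R (of_real (F (m * s)) * \<phi> (x - m * s)) = (F (m * s) * \<bar>m\<bar>) *\<^sub>R \<phi> (x - m * s)"
      by (simp add: scaleR_conv_of_real)
    then show "\<bar>m\<bar> *\<^sub>R (of_real (F (m * s)) * \<phi> (x - m * s)) = indicator {-1..1} s *\<^sub>R (\<kappa> s *\<^sub>R \<phi> (x - m * s))"
      by (simp only: F scaleR_scaleR)
  qed
  also have "(LINT s|lborel. indicator {-1..1} s *\<^sub>R (\<kappa> s *\<^sub>R \<phi> (x - m * s))) =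
      integral {-1..1} (\<lambda>s. \<kappa> s *\<^sub>R \<phi> (x - m * s))"
  proof -
    have "continuous_on {-1..1} (\<lambda>s. \<kappa> s *\<^sub>R \<phi> (x - m * s))"
      by (intro continuous_intros \<kappa> continuous_on_compose2[OF \<phi>]) auto
    from set_borel_integral_eq_integral(2)[OF borel_integrable_atLeastAtMost'[OF this]]
    show ?thesis by (simp add: set_lebesgue_integral_def)
  qed
  finally show ?thesis .
qed

lemma indicator_dilated:
  fixes c t s :: real
  assumes "c > 0" "t \<noteq> 0"
  shows "indicator {- (c * \<bar>t\<bar>)..c * \<bar>t\<bar>} (c * t * s) = (indicator {-1..1} s :: real)"
proof -
  have "c * \<bar>t\<bar> = \<bar>c * t\<bar>" using assms by (simp add: abs_mult)
  then have "c * t * s \<in> {- (c * \<bar>t\<bar>)..c * \<bar>t\<bar>} \<longleftrightarrow> \<bar>c * t\<bar> * \<bar>s\<bar> \<le> \<bar>c * t\<bar> * 1"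
    by (simp only: atLeastAtMost_iff abs_le_iff[symmetric] abs_mult[of "c * t" s, symmetric] mult_1_right) auto
  also have "\<dots> \<longleftrightarrow> \<bar>s\<bar> \<le> 1" using assms by (subst mult_le_cancel_left_pos) auto
  also have "\<dots> \<longleftrightarrow> s \<in> {-1..1}" by auto
  finally show ?thesis by (simp add: indicator_def)
qed

lemma radicand_dilated:
  assumes "s \<in> {-1..1::real}"
  shows "(sqrt (c\<^sup>2 * t\<^sup>2 - (c * t * s)\<^sup>2))\<^sup>2 = c\<^sup>2 * t\<^sup>2 * (1 - s\<^sup>2)"
proof -
  have "s\<^sup>2 \<le> 1" using assms by (auto simp: abs_square_le_1)
  then have "0 \<le> c\<^sup>2 * t\<^sup>2 * (1 - s\<^sup>2)" by simp
  moreover have "c\<^sup>2 * t\<^sup>2 - (c * t * s)\<^sup>2 = c\<^sup>2 * t\<^sup>2 * (1 - s\<^sup>2)"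
    by (simp add: power_mult_distrib algebra_simps)
  ultimately show ?thesis by simp
qed

text \<open>The Jacobian c |t| absorbs the sign, since sgn t |t| = t, and cancels the c in 1 / (2
  c). In the argument, alpha c = k / 4.\<close>

lemma psi_fun_dilated:
  assumes "c > 0" "t \<noteq> 0"
  shows "psi_fun k c t (c * t * s) * \<bar>c * t\<bar> = indicator {-1..1} s * wave_kernel (k / 4) t s"
proof (cases "s \<in> {-1..1}")
  case True
  have "(2 * (k / (4 * c)) * sqrt (c\<^sup>2 * t\<^sup>2 - (c * t * s)\<^sup>2))\<^sup>2 / 4 = (k / 4)\<^sup>2 * t\<^sup>2 * (1 - s\<^sup>2)"
    unfolding power_mult_distrib[of _ "sqrt _"] radicand_dilated[OF True]
    using assms by (simp add: power_mult_distrib power_divide)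
  then have "psi_fun k c t (c * t * s) * \<bar>c * t\<bar> =
      sgn t * (1 / (2 * c)) * bessel_series 0 ((k / 4)\<^sup>2 * t\<^sup>2 * (1 - s\<^sup>2)) * \<bar>c * t\<bar>"
    using True by (simp add: psi_fun_def Let_def bessel_I0_eq indicator_dilated[OF assms])
  also have "\<dots> = (sgn t * \<bar>t\<bar>) / 2 * bessel_series 0 ((k / 4)\<^sup>2 * t\<^sup>2 * (1 - s\<^sup>2))"
    using assms by (simp add: abs_mult)
  finally show ?thesis using True by (simp add: wave_kernel_def sgn_mult_abs)
qed (use assms in \<open>simp add: psi_fun_def Let_def indicator_dilated\<close>)

text \<open>The prefactor alpha c |t|, the alpha from \<open>bessel_quot\<close> and the Jacobian c
  |t| multiply to (k / 4)^2 t^2, so the absolute values disappear.\<close>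

lemma psi_t_fun_dilated:
  assumes "c > 0" "t \<noteq> 0"
  shows "psi_t_fun k c t (c * t * s) * \<bar>c * t\<bar> = indicator {-1..1} s * wave_kernel_t (k / 4) t s"
proof (cases "s \<in> {-1..1}")
  case True
  have "(k / (4 * c))\<^sup>2 * (c\<^sup>2 * t\<^sup>2 * (1 - s\<^sup>2)) = (k / 4)\<^sup>2 * t\<^sup>2 * (1 - s\<^sup>2)"
    using assms by (simp add: power_mult_distrib power_divide)
  moreover have "psi_t_fun k c t (c * t * s) * \<bar>c * t\<bar> =
      k / (4 * c) * c * \<bar>t\<bar> * (k / (4 * c) * bessel_series (Suc 0) ((k / (4 * c))\<^sup>2 * (c\<^sup>2 * t\<^sup>2 * (1 - s\<^sup>2)))) * \<bar>c * t\<bar>"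
    using True by (simp add: psi_t_fun_def Let_def bessel_quot_eq radicand_dilated indicator_dilated[OF assms])
  ultimately have "psi_t_fun k c t (c * t * s) * \<bar>c * t\<bar> =
      k / (4 * c) * c * \<bar>t\<bar> * (k / (4 * c) * bessel_series (Suc 0) ((k / 4)\<^sup>2 * t\<^sup>2 * (1 - s\<^sup>2))) * \<bar>c * t\<bar>"
    by (simp only:)
  also have "\<dots> = (k / 4)\<^sup>2 * \<bar>t\<bar>\<^sup>2 * bessel_series (Suc 0) ((k / 4)\<^sup>2 * t\<^sup>2 * (1 - s\<^sup>2))"
    using assms by (simp add: abs_mult power2_eq_square)
  finally show ?thesis using True by (simp add: wave_kernel_t_def)
qed (use assms in \<open>simp add: psi_t_fun_def Let_def indicator_dilated\<close>)

definition const_curve :: "(real \<Rightarrow> complex) \<Rightarrow> nat \<Rightarrow> real \<Rightarrow> real \<Rightarrow> complex" where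
  "const_curve \<phi> n t = nth_deriv n \<phi>"

lemma test_function_continuous: "\<phi> \<in> test_functions \<Longrightarrow> continuous_on S (nth_deriv n \<phi>)"
  using test_function_family[of \<phi>] unfolding deriv_family_def
  by (intro continuous_at_imp_continuous_on ballI has_vector_derivative_continuous) blast

lemma curve_deriv_const:
  assumes \<phi>: "\<phi> \<in> test_functions"
  shows "curve_deriv (const_curve \<phi>) (\<lambda>n t x. 0)"
proof -
  obtain R where R: "\<forall>x. \<bar>x\<bar> > R \<longrightarrow> \<phi> x = 0" using test_function_real_outside[OF \<phi>] by blast
  have "continuous_on UNIV (\<lambda>z::real \<times> real. nth_deriv n \<phi> (snd z))" for n
    by (intro continuous_on_compose2[OF test_function_continuous[OF \<phi>]] continuous_intros) auto
  then have "test_curve (const_curve \<phi>)"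
    using R test_function_family[OF \<phi>] unfolding test_curve_def
    by (auto simp: const_curve_def case_prod_unfold intro!: exI[of _ R])
  moreover have "test_curve (\<lambda>n t x. 0)"
    by (auto simp: test_curve_def deriv_family_def)
  ultimately show ?thesis by (simp add: curve_deriv_def const_curve_def)
qed

lemmas test_curve_const = curve_derivD(1)[OF curve_deriv_const]

text \<open>The dilation degenerates at t = 0. There both sides vanish, the left because sgn 0 = 0,
  the right because the kernel has the factor t.\<close>

lemma convolution_psi:
  assumes \<phi>: "\<phi> \<in> test_functions" and "c > 0"
  shows "convolution (psi k c t) \<phi> = wave_op c (k / 4) (const_curve \<phi>) 0 t"
proof (cases "t = 0")
  case True
  then show ?thesis
    by (simp add: fun_eq_iff convolution_def psi_def regular_dist_def psi_fun_def wave_op_def average_def wave_kernel_def)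
next
  case False
  have "continuous_on {-1..1} (wave_kernel (k / 4) t)"
    by (intro continuous_kernel_compose[OF continuous_wave_kernel] continuous_intros)
  from lborel_integral_dilated_kernel[OF _ test_function_continuous[OF \<phi>, of _ 0] this psi_fun_dilated[OF \<open>c > 0\<close> False, of k]]
  show ?thesis using False \<open>c > 0\<close>
    by (simp add: fun_eq_iff convolution_def psi_def regular_dist_def wave_op_def average_def const_curve_def)
qed

text \<open>At t = 0 the regular part drops out through its factor |t|, and the two Dirac masses
  merge, so both sides are \<open>\<phi>\<close>.\<close>

lemma convolution_psi_t:
  assumes \<phi>: "\<phi> \<in> test_functions" and "c > 0"
  shows "convolution (psi_t k c t) \<phi> = wave_op_t c (k / 4) (const_curve \<phi>) 0 t"
proof (cases "t = 0")
  case True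
  then show ?thesis
    by (simp add: fun_eq_iff convolution_def psi_t_def regular_dist_def psi_t_fun_def wave_op_t_def average_def
        wave_kernel_t_def dirac_def const_curve_def scaleR_conv_of_real)
next
  case False
  have "continuous_on {-1..1} (wave_kernel_t (k / 4) t)"
    by (intro continuous_kernel_compose[OF continuous_wave_kernel_t] continuous_intros)
  from lborel_integral_dilated_kernel[OF _ test_function_continuous[OF \<phi>, of _ 0] this psi_t_fun_dilated[OF \<open>c > 0\<close> False, of k]]
  show ?thesis using False \<open>c > 0\<close>
    by (simp add: fun_eq_iff convolution_def psi_t_def regular_dist_def wave_op_t_def average_def
        dirac_def const_curve_def scaleR_conv_of_real algebra_simps)
qed

section \<open>Transposes of W, V and L acting on distributions\<close>

lemma average_lincomb:
  assumes "continuous_kernel \<kappa>" "test_curve E" "test_curve F"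
    and "\<And>y. H n t y = a * E n t y + b * F n t y"
  shows "average c \<kappa> H n t x = a * average c \<kappa> E n t x + b * average c \<kappa> F n t x"
proof -
  let ?e = "\<lambda>s. \<kappa> t s *\<^sub>R E n t (x - c * t * s)" and ?f = "\<lambda>s. \<kappa> t s *\<^sub>R F n t (x - c * t * s)"
  note int = average_integrable[OF assms(1,2), of t n x c] average_integrable[OF assms(1,3), of t n x c]
  have "((\<lambda>s. a * ?e s + b * ?f s) has_integral (a * integral {-1..1} ?e + b * integral {-1..1} ?f)) {-1..1}"
    by (intro has_integral_add has_integral_mult_right integrable_integral int)
  then have "integral {-1..1} (\<lambda>s. a * ?e s + b * ?f s) = a * integral {-1..1} ?e + b * integral {-1..1} ?f"
    by (rule integral_unique)
  then show ?thesis by (simp add: average_def assms(4) scaleR_add_right)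
qed

lemma wave_op_lincomb:
  assumes "test_curve E" "test_curve F" "\<And>y. H n t y = a * E n t y + b * F n t y"
  shows "wave_op c \<alpha> H n t x = a * wave_op c \<alpha> E n t x + b * wave_op c \<alpha> F n t x"
  unfolding wave_op_def by (rule average_lincomb[where H = H, OF continuous_wave_kernel assms])

lemma wave_op_t_lincomb:
  assumes "test_curve E" "test_curve F" "\<And>y. H n t y = a * E n t y + b * F n t y"
  shows "wave_op_t c \<alpha> H n t x = a * wave_op_t c \<alpha> E n t x + b * wave_op_t c \<alpha> F n t x"
  unfolding wave_op_t_def average_lincomb[where H = H, OF continuous_wave_kernel_t assms]
  by (simp add: assms(3) algebra_simps)

lemma continuous_kernel_bounded:
  assumes "continuous_kernel \<kappa>"
  shows "\<exists>M\<ge>0. \<forall>s\<in>{-1..1}. \<bar>\<kappa> t s\<bar> \<le> M"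
proof -
  have "compact (\<kappa> t ` {-1..1})"
    by (intro compact_continuous_image continuous_kernel_compose[OF assms] continuous_intros) auto
  then obtain M where M: "\<forall>y\<in>\<kappa> t ` {-1..1}. norm y \<le> M" using compact_imp_bounded bounded_iff by metis
  then have "\<bar>\<kappa> t 0\<bar> \<le> M" by simp
  then have "M \<ge> 0" by linarith
  then show ?thesis using M by (intro exI[of _ M]) auto
qed

lemma distribution_wave_op:
  assumes u: "distribution u"
    and z: "\<And>\<phi>. \<phi> \<in> test_functions \<Longrightarrow> z \<phi> = u (wave_op c a (const_curve \<phi>) 0 t)"
  shows "distribution z"
proof -
  obtain M where M: "M \<ge> 0" "\<forall>s\<in>{-1..1}. \<bar>wave_kernel a t s\<bar> \<le> M"
    using continuous_kernel_bounded[OF continuous_wave_kernel] by blast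
  show ?thesis
  \<comment> \<open>Averaging loses no derivatives and widens supports by |c t|; the factor 2 is the
    length of [-1, 1].\<close>
  proof (rule distribution_compose[OF u, where m = 0 and M = "2 * M" and R = "\<bar>c * t\<bar>"
        and P = "\<lambda>\<phi> n. wave_op c a (const_curve \<phi>) n t"])
    fix \<phi> :: "real \<Rightarrow> complex" assume \<phi>: "\<phi> \<in> test_functions"
    show "deriv_family (\<lambda>n. wave_op c a (const_curve \<phi>) n t)"
      by (intro test_curve_family test_curve_wave_op test_curve_const \<phi>)
    show "wave_op c a (const_curve \<phi>) 0 t x = 0" if "\<And>x. \<bar>x\<bar> > \<rho> \<Longrightarrow> \<phi> x = 0" "\<bar>x\<bar> > \<rho> + \<bar>c * t\<bar>" for \<rho> x
      unfolding wave_op_def by (rule average_outside[of \<rho>]) (use that in \<open>simp_all add: const_curve_def\<close>)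
    show "norm (wave_op c a (const_curve \<phi>) n t x) \<le> 2 * M * B"
      if "\<And>j x. j \<le> 0 \<Longrightarrow> norm (nth_deriv (n + j) \<phi> x) \<le> B" for n x B
      unfolding wave_op_def
      by (rule norm_average_le[OF continuous_wave_kernel test_curve_const[OF \<phi>]])
        (use M that in \<open>auto simp: const_curve_def\<close>)
    show "wave_op c a (const_curve (\<lambda>x. r * \<phi> x + s * \<eta> x)) 0 t =
        (\<lambda>x. r * wave_op c a (const_curve \<phi>) 0 t x + s * wave_op c a (const_curve \<eta>) 0 t x)"
      if "\<eta> \<in> test_functions" for \<eta> r s
      by (rule ext, rule wave_op_lincomb) (simp_all add: test_curve_const \<phi> that const_curve_def)
  qed (rule z)
qed

lemma distribution_wave_op_t:
  assumes u: "distribution u"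
    and z: "\<And>\<phi>. \<phi> \<in> test_functions \<Longrightarrow> z \<phi> = u (wave_op_t c a (const_curve \<phi>) 0 t)"
  shows "distribution z"
proof -
  obtain M where M: "M \<ge> 0" "\<forall>s\<in>{-1..1}. \<bar>wave_kernel_t a t s\<bar> \<le> M"
    using continuous_kernel_bounded[OF continuous_wave_kernel_t] by blast
  show ?thesis
  \<comment> \<open>The 1 added to 2 M accounts for the two translates, each of weight 1/2.\<close>
  proof (rule distribution_compose[OF u, where m = 0 and M = "1 + 2 * M" and R = "\<bar>c * t\<bar>"
        and P = "\<lambda>\<phi> n. wave_op_t c a (const_curve \<phi>) n t"])
    fix \<phi> :: "real \<Rightarrow> complex" assume \<phi>: "\<phi> \<in> test_functions"
    show "deriv_family (\<lambda>n. wave_op_t c a (const_curve \<phi>) n t)"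
      by (intro test_curve_family test_curve_wave_op_t test_curve_const \<phi>)
    show "wave_op_t c a (const_curve \<phi>) 0 t x = 0" if out: "\<And>x. \<bar>x\<bar> > \<rho> \<Longrightarrow> \<phi> x = 0" "\<bar>x\<bar> > \<rho> + \<bar>c * t\<bar>" for \<rho> x
    proof -
      have "\<bar>x - c * t\<bar> > \<rho>" "\<bar>x + c * t\<bar> > \<rho>" using out(2) by linarith+
      moreover have "average c (wave_kernel_t a) (const_curve \<phi>) 0 t x = 0"
        by (rule average_outside[of \<rho>]) (use out in \<open>simp_all add: const_curve_def\<close>)
      ultimately show ?thesis using out(1) by (simp add: wave_op_t_def const_curve_def)
    qed
    show "norm (wave_op_t c a (const_curve \<phi>) n t x) \<le> (1 + 2 * M) * B"
      if B: "\<And>j x. j \<le> 0 \<Longrightarrow> norm (nth_deriv (n + j) \<phi> x) \<le> B" for n x B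
    proof -
      have "norm (average c (wave_kernel_t a) (const_curve \<phi>) n t x) \<le> 2 * M * B"
        by (rule norm_average_le[OF continuous_wave_kernel_t test_curve_const[OF \<phi>]])
          (use M B in \<open>auto simp: const_curve_def\<close>)
      moreover have "norm ((1/2) *\<^sub>R const_curve \<phi> n t y) \<le> B / 2" for y
        using B[of 0 y] by (simp add: const_curve_def)
      ultimately have "norm (wave_op_t c a (const_curve \<phi>) n t x) \<le> B / 2 + B / 2 + 2 * M * B"
        unfolding wave_op_t_def by (intro norm_triangle_le add_mono) auto
      then show ?thesis by (simp add: algebra_simps)
    qed
    show "wave_op_t c a (const_curve (\<lambda>x. r * \<phi> x + s * \<eta> x)) 0 t =
        (\<lambda>x. r * wave_op_t c a (const_curve \<phi>) 0 t x + s * wave_op_t c a (const_curve \<eta>) 0 t x)"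
      if "\<eta> \<in> test_functions" for \<eta> r s
      by (rule ext, rule wave_op_t_lincomb) (simp_all add: test_curve_const \<phi> that const_curve_def)
  qed (rule z)
qed

lemma test_curve_klein_gordon: "test_curve E \<Longrightarrow> test_curve (klein_gordon c a E)"
  unfolding klein_gordon_def[abs_def] by (intro test_curve_lincomb test_curve_shift)

lemma curve_deriv_klein_gordon:
  "curve_deriv E E' \<Longrightarrow> curve_deriv (klein_gordon c a E) (klein_gordon c a E')"
  unfolding klein_gordon_def[abs_def] by (intro curve_deriv_lincomb curve_deriv_shift)

lemma distribution_klein_gordon:
  assumes u: "distribution u"
    and z: "\<And>\<phi>. \<phi> \<in> test_functions \<Longrightarrow> z \<phi> = u (klein_gordon c a (const_curve \<phi>) 0 t)"
  shows "distribution z"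
\<comment> \<open>L is local, so supports do not grow, but it costs two derivatives.\<close>
proof (rule distribution_compose[OF u, where m = 2 and M = "c\<^sup>2 + 4 * a\<^sup>2" and R = 0
      and P = "\<lambda>\<phi> n. klein_gordon c a (const_curve \<phi>) n t"])
  fix \<phi> :: "real \<Rightarrow> complex" assume \<phi>: "\<phi> \<in> test_functions"
  show "deriv_family (\<lambda>n. klein_gordon c a (const_curve \<phi>) n t)"
    by (intro test_curve_family test_curve_klein_gordon test_curve_const \<phi>)
  show "klein_gordon c a (const_curve \<phi>) 0 t x = 0" if out: "\<And>x. \<bar>x\<bar> > \<rho> \<Longrightarrow> \<phi> x = 0" "\<bar>x\<bar> > \<rho> + 0" for \<rho> x
    using deriv_family_outside[OF test_function_family[OF \<phi>], of \<rho> x] out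
    by (simp add: klein_gordon_def const_curve_def)
  show "norm (klein_gordon c a (const_curve \<phi>) n t x) \<le> (c\<^sup>2 + 4 * a\<^sup>2) * B"
    if B: "\<And>j x. j \<le> 2 \<Longrightarrow> norm (nth_deriv (n + j) \<phi> x) \<le> B" for n x B
  proof -
    have "norm (klein_gordon c a (const_curve \<phi>) n t x) \<le> c\<^sup>2 * B + 4 * a\<^sup>2 * B"
      unfolding klein_gordon_def const_curve_def
      by (rule norm_triangle_le, rule add_mono) (use B[of 2 x] B[of 0 x] in \<open>auto intro!: mult_left_mono\<close>)
    then show ?thesis by (simp add: algebra_simps)
  qed
  show "klein_gordon c a (const_curve (\<lambda>x. r * \<phi> x + s * \<eta> x)) 0 t =
      (\<lambda>x. r * klein_gordon c a (const_curve \<phi>) 0 t x + s * klein_gordon c a (const_curve \<eta>) 0 t x)"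
    if \<eta>: "\<eta> \<in> test_functions" for \<eta> r s
  proof -
    have "deriv_family (\<lambda>n x. r * nth_deriv n \<phi> x + s * nth_deriv n \<eta> x)"
      using test_function_family[OF \<phi>] test_function_family[OF \<eta>]
      by (auto simp: deriv_family_def intro!: derivative_eq_intros)
    from nth_deriv_deriv_family[OF this]
    show ?thesis by (simp add: fun_eq_iff klein_gordon_def const_curve_def scaleR_conv_of_real algebra_simps)
  qed
qed (rule z)

lemma distribution_wave_op_klein_gordon:
  assumes u: "distribution u"
    and z: "\<And>\<phi>. \<phi> \<in> test_functions \<Longrightarrow> z \<phi> = u (wave_op c a (klein_gordon c a (const_curve \<phi>)) 0 t)"
  shows "distribution z"
proof (rule distribution_klein_gordon)
  show "distribution (\<lambda>\<phi>. u (wave_op c a (const_curve \<phi>) 0 t))"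
    by (rule distribution_wave_op[OF u]) simp
  fix \<phi> :: "real \<Rightarrow> complex" assume \<phi>: "\<phi> \<in> test_functions"
  show "z \<phi> = u (wave_op c a (const_curve (klein_gordon c a (const_curve \<phi>) 0 t)) 0 t)"
    unfolding z[OF \<phi>]
    \<comment> \<open>At order 0 and time t, \<open>wave_op\<close> reads only the function
      \<open>E 0 t\<close>, so L \<open>\<phi>\<close> may be frozen into a constant curve.\<close>
    by (intro arg_cong[where f = u] ext) (simp add: wave_op_def average_def const_curve_def)
qed

subsection \<open>Time slices of test functions of the plane\<close>

lemma partial_derivs_append: "partial_derivs (bs @ cs) \<phi> = partial_derivs bs (partial_derivs cs \<phi>)"
  by (simp add: partial_derivs_def)

lemma partial_derivs_Cons: "partial_derivs (b # bs) \<phi> = dir_deriv b (partial_derivs bs \<phi>)"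
  by (simp add: partial_derivs_def)

lemma partial_derivs_Nil [simp]: "partial_derivs [] \<phi> = \<phi>"
  by (simp add: partial_derivs_def)

lemma smooth_differentiable:
  "smooth \<phi> \<Longrightarrow> bs \<in> lists Basis \<Longrightarrow> partial_derivs bs \<phi> differentiable (at x)"
  by (simp add: smooth_def)

lemma smooth_partial_derivs:
  "smooth \<phi> \<Longrightarrow> bs \<in> lists Basis \<Longrightarrow> smooth (partial_derivs bs \<phi>)"
  unfolding smooth_def by (metis partial_derivs_append append_in_lists_conv)

lemma smooth_continuous:
  assumes "smooth \<phi>"
  shows "continuous_on S \<phi>"
  using smooth_differentiable[OF assms lists.Nil]
  by (intro continuous_at_imp_continuous_on ballI differentiable_imp_continuous_within) simp

lemma smooth_has_derivative:
  assumes "smooth \<phi>"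
  shows "(\<phi> has_derivative (\<lambda>h. dir_deriv h \<phi> x)) (at x)"
  using smooth_differentiable[OF assms lists.Nil, of x]
  by (simp add: dir_deriv_def frechet_derivative_works)

lemma real_plane_Basis: "(1, 0) \<in> (Basis :: (real \<times> real) set)" "(0, 1) \<in> (Basis :: (real \<times> real) set)"
  by (auto simp: Basis_prod_def)

lemma smooth_dir_deriv:
  assumes "smooth \<phi>" "b \<in> Basis"
  shows "smooth (dir_deriv b \<phi>)"
  using smooth_partial_derivs[OF assms(1), of "[b]"] assms(2) by (simp add: partial_derivs_Cons)

lemma smooth_has_vector_derivative_fst:
  assumes "smooth (\<phi> :: real \<times> real \<Rightarrow> complex)"
  shows "((\<lambda>x. \<phi> (x, t)) has_vector_derivative dir_deriv (1, 0) \<phi> (x, t)) (at x)"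
proof -
  have D: "(\<phi> has_derivative (\<lambda>h. dir_deriv h \<phi> (x, t))) (at (x, t))" by (rule smooth_has_derivative[OF assms])
  then interpret D: bounded_linear "\<lambda>h. dir_deriv h \<phi> (x, t)" by (rule has_derivative_bounded_linear)
  have "((\<lambda>x. (x, t)) has_derivative (\<lambda>h. (h, 0))) (at x)" by (auto intro!: derivative_eq_intros)
  from has_derivative_compose[OF this D]
  show ?thesis unfolding has_vector_derivative_def
  proof (rule back_subst[of "\<lambda>D. (_ has_derivative D) _"], intro ext)
    show "dir_deriv (h, 0) \<phi> (x, t) = h *\<^sub>R dir_deriv (1, 0) \<phi> (x, t)" for h
      using D.scaleR[of h "(1, 0)"] by (simp only: scaleR_Pair real_scaleR_def mult_1_right mult_zero_right)
  qed
qed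

lemma smooth_has_vector_derivative_snd:
  assumes "smooth (\<phi> :: real \<times> real \<Rightarrow> complex)"
  shows "((\<lambda>t. \<phi> (x, t)) has_vector_derivative dir_deriv (0, 1) \<phi> (x, t)) (at t)"
proof -
  have D: "(\<phi> has_derivative (\<lambda>h. dir_deriv h \<phi> (x, t))) (at (x, t))" by (rule smooth_has_derivative[OF assms])
  then interpret D: bounded_linear "\<lambda>h. dir_deriv h \<phi> (x, t)" by (rule has_derivative_bounded_linear)
  have "((\<lambda>t. (x, t)) has_derivative (\<lambda>h. (0, h))) (at t)" by (auto intro!: derivative_eq_intros)
  from has_derivative_compose[OF this D]
  show ?thesis unfolding has_vector_derivative_def
  proof (rule back_subst[of "\<lambda>D. (_ has_derivative D) _"], intro ext)
    show "dir_deriv (0, h) \<phi> (x, t) = h *\<^sub>R dir_deriv (0, 1) \<phi> (x, t)" for h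
      using D.scaleR[of h "(0, 1)"] by (simp only: scaleR_Pair real_scaleR_def mult_1_right mult_zero_right)
  qed
qed

text \<open>Differentiate \<open>\<phi>(y, t) - \<phi>(x - 1, t) = \<integral> \<partial>\<^sub>x \<phi>\<close> first in \<open>t\<close>, under the integral, and then
  in \<open>y\<close>.\<close>

lemma smooth_mixed_derivatives:
  assumes "smooth (\<phi> :: real \<times> real \<Rightarrow> complex)"
  shows "dir_deriv (1, 0) (dir_deriv (0, 1) \<phi>) = dir_deriv (0, 1) (dir_deriv (1, 0) \<phi>)"
proof
  fix z :: "real \<times> real"
  obtain x t where z: "z = (x, t)" by (cases z)
  let ?X = "dir_deriv (1, 0) \<phi>" and ?T = "dir_deriv (0, 1) \<phi>"
  let ?TX = "dir_deriv (0, 1) ?X"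
  note smooth = smooth_dir_deriv[OF assms real_plane_Basis(1)] smooth_dir_deriv[OF assms real_plane_Basis(2)]
  note smooth2 = smooth_dir_deriv[OF smooth(1) real_plane_Basis(2)]
  have cont: "continuous_on S (\<lambda>y. \<psi> (f y, g y))"
    if "smooth \<psi>" "continuous_on S f" "continuous_on S g" for \<psi> :: "real \<times> real \<Rightarrow> complex" and S :: "'b::topological_space set" and f g
    by (rule continuous_on_compose2[OF smooth_continuous[OF that(1)] continuous_on_Pair[OF that(2,3)]]) auto
  have int: "?T (y, t) - ?T (x - 1, t) = integral {x - 1..y} (\<lambda>y. ?TX (y, t))" if "y \<in> {x - 1..x + 1}" for y
  proof (rule vector_derivative_unique_at)
    show "((\<lambda>s. \<phi> (y, s) - \<phi> (x - 1, s)) has_vector_derivative ?T (y, t) - ?T (x - 1, t)) (at t)"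
      by (intro has_vector_derivative_diff smooth_has_vector_derivative_snd assms)
    have "((\<lambda>s. integral (cbox (x - 1) y) (\<lambda>y. ?X (y, s))) has_vector_derivative
        integral (cbox (x - 1) y) (\<lambda>y. ?TX (y, t))) (at t within UNIV)"
    proof (rule leibniz_rule_vector_derivative)
      show "((\<lambda>s. ?X (y, s)) has_vector_derivative ?TX (y, s)) (at s within UNIV)" for s y
        using smooth_has_vector_derivative_snd[OF smooth(1)] by simp
      show "(\<lambda>y. ?X (y, s)) integrable_on cbox (x - 1) y" for s
        by (intro integrable_continuous cont smooth(1) continuous_intros)
      show "continuous_on (UNIV \<times> cbox (x - 1) y) (\<lambda>(s, y). ?TX (y, s))"
        unfolding case_prod_unfold by (intro cont smooth2 continuous_intros)
    qed auto
    moreover have "integral (cbox (x - 1) y) (\<lambda>y. ?X (y, s)) = \<phi> (y, s) - \<phi> (x - 1, s)" for s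
      unfolding box_real
      by (intro integral_unique fundamental_theorem_of_calculus)
        (use that in \<open>auto intro: has_vector_derivative_at_within smooth_has_vector_derivative_fst[OF assms]\<close>)
    ultimately show "((\<lambda>s. \<phi> (y, s) - \<phi> (x - 1, s)) has_vector_derivative
        integral {x - 1..y} (\<lambda>y. ?TX (y, t))) (at t)" by (simp add: box_real)
  qed
  have "((\<lambda>y. integral {x - 1..y} (\<lambda>y. ?TX (y, t))) has_vector_derivative ?TX (x, t)) (at x within {x - 1..x + 1})"
    by (rule integral_has_vector_derivative) (auto intro!: cont smooth2 continuous_intros)
  then have "((\<lambda>y. ?T (y, t) - ?T (x - 1, t)) has_vector_derivative ?TX (x, t)) (at x within {x - 1..x + 1})"
    by (rule has_vector_derivative_transform[rotated -1]) (auto simp: int)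
  \<comment> \<open>The point x is interior to [x - 1, x + 1], so the derivative within the interval
    is a full one.\<close>
  then have "((\<lambda>y. ?T (y, t) - ?T (x - 1, t)) has_vector_derivative ?TX (x, t)) (at x)"
    by (simp add: at_within_Icc_at)
  moreover have "((\<lambda>y. ?T (y, t) - ?T (x - 1, t)) has_vector_derivative dir_deriv (1, 0) ?T (x, t) - 0) (at x)"
    by (intro has_vector_derivative_diff smooth_has_vector_derivative_fst smooth(2) has_vector_derivative_const)
  ultimately show "dir_deriv (1, 0) ?T z = ?TX z"
    unfolding z using vector_derivative_unique_at by fastforce
qed

text \<open>Points of the plane are \<open>(x, t)\<close>, whereas curves take the time argument first.\<close>

definition slice :: "(real \<times> real \<Rightarrow> complex) \<Rightarrow> nat \<Rightarrow> real \<Rightarrow> real \<Rightarrow> complex" where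
  "slice \<phi> n t x = partial_derivs (replicate n (1, 0)) \<phi> (x, t)"

lemma smooth_partial_derivs_fst:
  "smooth \<phi> \<Longrightarrow> smooth (partial_derivs (replicate n (1, 0)) (\<phi> :: real \<times> real \<Rightarrow> complex))"
  by (rule smooth_partial_derivs) (auto simp: in_lists_conv_set real_plane_Basis)

text \<open>\<open>smooth\<close> grants all iterated partial derivatives without stating their
  symmetry, so d/dt is moved past the x-derivatives one at a time. This makes the slices of the time
  derivative the time derivative of the slices at every order.\<close>

lemma partial_derivs_fst_snd:
  assumes "smooth (\<phi> :: real \<times> real \<Rightarrow> complex)"
  shows "dir_deriv (0, 1) (partial_derivs (replicate n (1, 0)) \<phi>) = partial_derivs (replicate n (1, 0)) (dir_deriv (0, 1) \<phi>)"
  by (induction n) (simp_all add: partial_derivs_Cons smooth_mixed_derivatives[OF smooth_partial_derivs_fst[OF assms], symmetric])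

lemma dir_deriv_outside:
  fixes \<phi> :: "'a::euclidean_space \<Rightarrow> complex"
  assumes "\<And>z. norm z > R \<Longrightarrow> \<phi> z = 0" "norm z > R"
  shows "dir_deriv b \<phi> z = 0"
proof -
  have "open {z :: 'a. norm z > R}" by (intro open_Collect_less continuous_intros)
  then have "(\<phi> has_derivative (\<lambda>h. 0)) (at z)"
    by (rule has_derivative_transform_within_open[OF has_derivative_const]) (use assms in auto)
  then show ?thesis by (rule dir_deriv_has_derivative)
qed

lemma test_curve_slice:
  assumes smooth: "smooth \<phi>" and out: "\<And>z. norm z > R \<Longrightarrow> \<phi> z = 0"
  shows "test_curve (slice \<phi>)"
  unfolding test_curve_def
proof (intro conjI allI)
  show "deriv_family (\<lambda>n. slice \<phi> n t)" for t
    unfolding deriv_family_def slice_def[abs_def]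
    using smooth_has_vector_derivative_fst[OF smooth_partial_derivs_fst[OF smooth]] by (simp add: partial_derivs_Cons)
  show "continuous_on UNIV (\<lambda>(t, x). slice \<phi> n t x)" for n
    unfolding slice_def case_prod_unfold
    by (rule continuous_on_compose2[OF smooth_continuous[OF smooth_partial_derivs_fst[OF smooth], of UNIV]])
      (auto intro!: continuous_intros)
  show "\<exists>R. \<forall>t x. \<bar>t\<bar> \<le> T \<longrightarrow> \<bar>x\<bar> > R \<longrightarrow> slice \<phi> 0 t x = 0" for T
  proof (intro exI[of _ R] allI impI)
    fix t x :: real assume "\<bar>x\<bar> > R"
    moreover have "\<bar>x\<bar> \<le> norm (x, t)" using norm_fst_le[of x t] by simp
    ultimately show "slice \<phi> 0 t x = 0" using out by (simp add: slice_def)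
  qed
qed

lemma curve_deriv_slice:
  assumes smooth: "smooth \<phi>" and out: "\<And>z. norm z > R \<Longrightarrow> \<phi> z = 0"
  shows "curve_deriv (slice \<phi>) (slice (dir_deriv (0, 1) \<phi>))"
  unfolding curve_deriv_def
proof (intro conjI allI)
  show "test_curve (slice \<phi>)" by (rule test_curve_slice[OF assms])
  show "test_curve (slice (dir_deriv (0, 1) \<phi>))"
    by (rule test_curve_slice[OF smooth_dir_deriv[OF smooth real_plane_Basis(2)] dir_deriv_outside[OF out]])
  show "((\<lambda>t. slice \<phi> n t x) has_vector_derivative slice (dir_deriv (0, 1) \<phi>) n t x) (at t)" for n t x
    unfolding slice_def partial_derivs_fst_snd[OF smooth, symmetric]
    by (rule smooth_has_vector_derivative_snd[OF smooth_partial_derivs_fst[OF smooth]])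
qed

lemma slice_outside:
  assumes smooth: "smooth \<phi>" and out: "\<And>z. norm z > R \<Longrightarrow> \<phi> z = 0" and "\<bar>t\<bar> > R"
  shows "slice \<phi> n t = (\<lambda>x. 0)"
proof -
  have "norm (x, t) > R" for x :: real using norm_snd_le[of t x] \<open>\<bar>t\<bar> > R\<close> by simp
  then have "slice \<phi> 0 t = (\<lambda>x. 0)" using out by (simp add: slice_def fun_eq_iff)
  then have "slice \<phi> 0 t = (\<lambda>n x. 0) 0" by simp
  have "deriv_family (\<lambda>n. slice \<phi> n t)" by (rule test_curve_family[OF test_curve_slice[OF smooth out]])
  from nth_deriv_deriv_family[OF this, of n] nth_deriv_deriv_family[of "\<lambda>n x. 0" n]
  show ?thesis using \<open>slice \<phi> 0 t = (\<lambda>x. 0)\<close> by (simp add: deriv_family_def)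
qed

subsection \<open>The solution\<close>

text \<open>The pairing of v(t) with a moving test function \<open>E 0 t\<close>; \<open>h\<close>
  is the initial velocity g + (k/2) f. A constant curve gives back v(t), a \<open>slice\<close>
  gives pairings as in the weak equation.\<close>

definition wave_solution ::
    "real \<Rightarrow> real \<Rightarrow> ((real \<Rightarrow> complex) \<Rightarrow> complex) \<Rightarrow> ((real \<Rightarrow> complex) \<Rightarrow> complex) \<Rightarrow>
     (nat \<Rightarrow> real \<Rightarrow> real \<Rightarrow> complex) \<Rightarrow> real \<Rightarrow> complex" where
  "wave_solution c a f h E t = f (wave_op_t c a E 0 t) + h (wave_op c a E 0 t)"

definition wave_solution_t ::
    "real \<Rightarrow> real \<Rightarrow> ((real \<Rightarrow> complex) \<Rightarrow> complex) \<Rightarrow> ((real \<Rightarrow> complex) \<Rightarrow> complex) \<Rightarrow>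
     (nat \<Rightarrow> real \<Rightarrow> real \<Rightarrow> complex) \<Rightarrow> real \<Rightarrow> complex" where
  "wave_solution_t c a f h E t = f (wave_op c a (klein_gordon c a E) 0 t) + h (wave_op_t c a E 0 t)"

lemma distribution_curve_sum:
  assumes "distribution u" "test_curve E" "test_curve F"
  shows "u (\<lambda>x. 1 *\<^sub>R E 0 t x + 1 *\<^sub>R F 0 t x) = u (E 0 t) + u (F 0 t)"
  using distribution_lincomb_scaleR[OF assms(1) test_curve_test_function[OF assms(2), of t] test_curve_test_function[OF assms(3), of t], of 1 1]
  by simp

text \<open>Product rule: V' = W L under f and W' = V under h give the velocity, and the motion of
  the test function gives the second summand.\<close>

lemma wave_solution_has_vector_derivative:
  assumes f: "distribution f" and h: "distribution h" and E: "curve_deriv E E'"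
  shows "(wave_solution c a f h E has_vector_derivative
    wave_solution_t c a f h E t + wave_solution c a f h E' t) (at t)"
proof -
  note EE = curve_derivD(1,2)[OF E]
  note curves = test_curve_wave_op test_curve_wave_op_t test_curve_klein_gordon EE
  have "(wave_solution c a f h E has_vector_derivative
      f (\<lambda>x. 1 *\<^sub>R wave_op c a (klein_gordon c a E) 0 t x + 1 *\<^sub>R wave_op_t c a E' 0 t x) +
      h (\<lambda>x. 1 *\<^sub>R wave_op_t c a E 0 t x + 1 *\<^sub>R wave_op c a E' 0 t x)) (at t)"
    unfolding wave_solution_def[abs_def]
    by (intro has_vector_derivative_add
        distribution_curve_has_vector_derivative[OF f curve_deriv_wave_op_t[OF E]]
        distribution_curve_has_vector_derivative[OF h curve_deriv_wave_op[OF E]])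
  then show ?thesis
    unfolding distribution_curve_sum[OF f curves(1)[OF curves(3)[OF EE(1)]] curves(2)[OF EE(2)]]
      distribution_curve_sum[OF h curves(2)[OF EE(1)] curves(1)[OF EE(2)]]
    by (simp add: wave_solution_def wave_solution_t_def add_ac)
qed

text \<open>The rule W' = V on the curve L E under f, and V' = W L under h, reproduce the solution
  paired with L E. This is v_tt = L v, since L is its own transpose.\<close>

lemma wave_solution_t_has_vector_derivative:
  assumes f: "distribution f" and h: "distribution h" and E: "curve_deriv E E'"
  shows "(wave_solution_t c a f h E has_vector_derivative
    wave_solution c a f h (klein_gordon c a E) t + wave_solution_t c a f h E' t) (at t)"
proof -
  note EE = curve_derivD(1,2)[OF E]
  note LE = curve_deriv_klein_gordon[OF E, of c a]
  note curves = test_curve_wave_op test_curve_wave_op_t test_curve_klein_gordon EE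
  have "(wave_solution_t c a f h E has_vector_derivative
      f (\<lambda>x. 1 *\<^sub>R wave_op_t c a (klein_gordon c a E) 0 t x + 1 *\<^sub>R wave_op c a (klein_gordon c a E') 0 t x) +
      h (\<lambda>x. 1 *\<^sub>R wave_op c a (klein_gordon c a E) 0 t x + 1 *\<^sub>R wave_op_t c a E' 0 t x)) (at t)"
    unfolding wave_solution_t_def[abs_def]
    by (intro has_vector_derivative_add
        distribution_curve_has_vector_derivative[OF f curve_deriv_wave_op[OF LE]]
        distribution_curve_has_vector_derivative[OF h curve_deriv_wave_op_t[OF E]])
  then show ?thesis
    unfolding distribution_curve_sum[OF f curves(2)[OF curves(3)[OF EE(1)]] curves(1)[OF curves(3)[OF EE(2)]]]
      distribution_curve_sum[OF h curves(1)[OF curves(3)[OF EE(1)]] curves(2)[OF EE(2)]]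
    by (simp add: wave_solution_def wave_solution_t_def add_ac)
qed

lemma wave_solution_zero:
  assumes "distribution f" "distribution h" "E 0 t = (\<lambda>x. 0)"
  shows "wave_solution c a f h E t = 0"
proof -
  have "wave_op c a E 0 t = (\<lambda>x. 0)" "wave_op_t c a E 0 t = (\<lambda>x. 0)"
    using assms(3) by (simp_all add: fun_eq_iff wave_op_def wave_op_t_def average_def)
  then show ?thesis using assms(1,2) by (simp add: wave_solution_def distribution_zero)
qed

lemma wave_solution_t_zero:
  assumes "distribution f" "distribution h" "\<And>n. E n t = (\<lambda>x. 0)"
  shows "wave_solution_t c a f h E t = 0"
proof -
  have "wave_op c a (klein_gordon c a E) 0 t = (\<lambda>x. 0)" "wave_op_t c a E 0 t = (\<lambda>x. 0)"
    using assms(3) by (simp_all add: fun_eq_iff wave_op_def wave_op_t_def average_def klein_gordon_def)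
  then show ?thesis using assms(1,2) by (simp add: wave_solution_t_def distribution_zero)
qed

text \<open>Lets the functional v(t), defined on fixed test functions, be evaluated on a moving one
  by freezing the curve at time t.\<close>

lemma wave_solution_local:
  assumes "E 0 t = F 0 t"
  shows "wave_solution c a f h E t = wave_solution c a f h F t"
proof -
  have "wave_op c a E 0 t = wave_op c a F 0 t" "wave_op_t c a E 0 t = wave_op_t c a F 0 t"
    using assms by (simp_all add: fun_eq_iff wave_op_def wave_op_t_def average_def)
  then show ?thesis by (simp add: wave_solution_def)
qed

lemma wave_solution_diff:
  assumes f: "distribution f" and h: "distribution h" and E: "test_curve E" and F: "test_curve F"
  shows "wave_solution c a f h (\<lambda>n t x. 1 *\<^sub>R E n t x + (-1) *\<^sub>R F n t x) t =
    wave_solution c a f h E t - wave_solution c a f h F t"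
proof -
  let ?H = "\<lambda>n t x. 1 *\<^sub>R E n t x + (-1) *\<^sub>R F n t x"
  have "wave_op c a ?H 0 t = (\<lambda>x. 1 * wave_op c a E 0 t x + (-1) * wave_op c a F 0 t x)"
    by (rule ext, rule wave_op_lincomb[OF E F]) simp
  moreover have "wave_op_t c a ?H 0 t = (\<lambda>x. 1 * wave_op_t c a E 0 t x + (-1) * wave_op_t c a F 0 t x)"
    by (rule ext, rule wave_op_t_lincomb[OF E F]) simp
  moreover note distribution_lincomb[OF f test_curve_test_function[OF test_curve_wave_op_t[OF E]]
      test_curve_test_function[OF test_curve_wave_op_t[OF F]], of 1 c a t "-1" c a t]
    distribution_lincomb[OF h test_curve_test_function[OF test_curve_wave_op[OF E]]
      test_curve_test_function[OF test_curve_wave_op[OF F]], of 1 c a t "-1" c a t]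
  ultimately show ?thesis by (simp only: wave_solution_def) simp
qed

lemma distribution_wave_solution:
  assumes "distribution f" "distribution h"
    and "\<And>\<phi>. \<phi> \<in> test_functions \<Longrightarrow> z \<phi> = wave_solution c a f h (const_curve \<phi>) t"
  shows "distribution z"
  by (rule distribution_lincombI[where a = 1 and b = 1, OF distribution_wave_op_t[OF assms(1) refl] distribution_wave_op[OF assms(2) refl]])
    (simp add: assms(3) wave_solution_def)

lemma distribution_wave_solution_t:
  assumes "distribution f" "distribution h"
  shows "distribution (\<lambda>\<phi>. wave_solution_t c a f h (const_curve \<phi>) t)"
  by (rule distribution_lincombI[where a = 1 and b = 1, OF distribution_wave_op_klein_gordon[OF assms(1) refl] distribution_wave_op_t[OF assms(2) refl]])
    (simp add: wave_solution_t_def)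

lemma C1_dist_wave_solution:
  assumes f: "distribution f" and h: "distribution h"
    and v: "\<And>t \<phi>. \<phi> \<in> test_functions \<Longrightarrow> v t \<phi> = wave_solution c a f h (const_curve \<phi>) t"
  shows "C1_dist v (\<lambda>t \<phi>. wave_solution_t c a f h (const_curve \<phi>) t)"
  unfolding C1_dist_def
proof (intro conjI allI ballI)
  show "distribution (v t)" for t by (rule distribution_wave_solution[OF f h]) (rule v)
  show "distribution (\<lambda>\<phi>. wave_solution_t c a f h (const_curve \<phi>) t)" for t
    by (rule distribution_wave_solution_t[OF f h])
  fix \<phi> :: "real \<Rightarrow> complex" and t assume \<phi>: "\<phi> \<in> test_functions"
  have "(wave_solution c a f h (const_curve \<phi>) has_vector_derivative wave_solution_t c a f h (const_curve \<phi>) t) (at t)"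
    using wave_solution_has_vector_derivative[OF f h curve_deriv_const[OF \<phi>], of c a t]
    by (simp add: wave_solution_zero[OF f h])
  then show "((\<lambda>s. (v (t + s) \<phi> - v t \<phi>) / of_real s) \<longlongrightarrow> wave_solution_t c a f h (const_curve \<phi>) t) (at 0)"
    by (simp add: has_vector_derivative_iff_tendsto v[OF \<phi>] scaleR_conv_of_real divide_inverse mult.commute)
  have "isCont (wave_solution_t c a f h (const_curve \<phi>)) t"
    by (rule has_vector_derivative_continuous[OF wave_solution_t_has_vector_derivative[OF f h curve_deriv_const[OF \<phi>]]])
  then show "((\<lambda>s. wave_solution_t c a f h (const_curve \<phi>) (t + s)) \<longlongrightarrow> wave_solution_t c a f h (const_curve \<phi>) t) (at 0)"
    by (simp add: isCont_iff)
qed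

lemma weak_solution_wave_solution:
  assumes f: "distribution f" and h: "distribution h"
    and v: "\<And>t \<phi>. \<phi> \<in> test_functions \<Longrightarrow> v t \<phi> = wave_solution c (k / 4) f h (const_curve \<phi>) t"
  shows "weak_solution k c v"
  unfolding weak_solution_def
proof
  fix \<phi> :: "real \<times> real \<Rightarrow> complex" assume \<phi>: "\<phi> \<in> test_functions"
  define a where "a = k / 4"
  let ?u = "wave_solution c a f h" and ?u' = "wave_solution_t c a f h"
  let ?\<phi>' = "dir_deriv (0, 1) \<phi>" and ?\<phi>'' = "dir_deriv (0, 1) (dir_deriv (0, 1) \<phi>)"
  obtain R where out: "\<And>z. norm z > R \<Longrightarrow> \<phi> z = 0" using test_functionE[OF \<phi>] by blast
  note out' = dir_deriv_outside[OF out]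
  have smooth: "smooth \<phi>" using \<phi> by (simp add: test_functions_def)
  note smooth' = smooth_dir_deriv[OF smooth real_plane_Basis(2)]
  note deriv = curve_deriv_slice[OF smooth out] curve_deriv_slice[OF smooth' out']
  note curves = curve_derivD(1)[OF deriv(1)] curve_derivD(2)[OF deriv(2)]
  \<comment> \<open>The slices of phi_tt - L phi, kept with all x-derivatives so that the pairing is
    continuous in t.\<close>
  define X where "X n t x = 1 *\<^sub>R slice ?\<phi>'' n t x + (-1) *\<^sub>R klein_gordon c a (slice \<phi>) n t x" for n t x
  have X: "test_curve X"
    unfolding X_def[abs_def] by (intro test_curve_lincomb test_curve_klein_gordon curves)
  have X0: "X 0 t x = partial_derivs [(0, 1), (0, 1)] \<phi> (x, t)
      - of_real (c\<^sup>2) * partial_derivs [(1, 0), (1, 0)] \<phi> (x, t) - of_real (k\<^sup>2 / 4) * \<phi> (x, t)" for t x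
    by (simp add: X_def slice_def klein_gordon_def partial_derivs_Cons numeral_2_eq_2 a_def scaleR_conv_of_real power_divide)
  have vX: "v t (X 0 t) = ?u X t" for t
    unfolding v[OF test_curve_test_function[OF X]] a_def[symmetric]
    by (rule wave_solution_local) (simp add: const_curve_def)
  \<comment> \<open>\<open>\<langle>v, \<phi>\<^sub>t\<rangle> - \<langle>v\<^sub>t, \<phi>\<rangle>\<close> is a compactly supported primitive of the pairing\<close>
  let ?F = "\<lambda>t. ?u (slice ?\<phi>') t - ?u' (slice \<phi>) t"
  \<comment> \<open>Both product rules contribute the pairing of v_t with phi_t; it cancels in the
    difference, leaving v paired with phi_tt - L phi.\<close>
  have F: "(?F has_vector_derivative ?u X t) (at t)" for t
    using has_vector_derivative_diff[OF
        wave_solution_has_vector_derivative[OF f h deriv(2), where c = c and a = a and t = t]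
        wave_solution_t_has_vector_derivative[OF f h deriv(1), where c = c and a = a and t = t]]
    by (simp add: X_def[abs_def] wave_solution_diff[OF f h curves(2) test_curve_klein_gordon[OF curves(1)], simplified])
  have cont: "continuous_on S (?u X)" for S
    unfolding wave_solution_def[abs_def]
    by (intro continuous_at_imp_continuous_on ballI continuous_intros
        distribution_curve_isCont f h test_curve_wave_op test_curve_wave_op_t X)
  have zero: "slice \<phi> n t = (\<lambda>x. 0)" if "\<bar>t\<bar> > R" for n t
    by (rule slice_outside[OF smooth out that])
  have zero': "slice ?\<phi>' n t = (\<lambda>x. 0)" if "\<bar>t\<bar> > R" for n t
    by (rule slice_outside[OF smooth' out' that])
  have zero'': "slice ?\<phi>'' n t = (\<lambda>x. 0)" if "\<bar>t\<bar> > R" for n t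
    by (rule slice_outside[OF smooth_dir_deriv[OF smooth' real_plane_Basis(2)] dir_deriv_outside[OF out'] that])
  have F0: "?F t = 0" if "\<bar>t\<bar> > R" for t
    by (simp add: wave_solution_zero[OF f h] wave_solution_t_zero[OF f h] zero[OF that] zero'[OF that])
  have uX0: "?u X t = 0" if "\<bar>t\<bar> > R" for t
    by (rule wave_solution_zero[OF f h]) (simp add: fun_eq_iff X_def zero[OF that] zero''[OF that] klein_gordon_def)
  \<comment> \<open>T is positive and exceeds R whatever the sign of R, so the primitive vanishes at
    both ends and the integrand vanishes outside [-T, T].\<close>
  define T where "T = \<bar>R\<bar> + 1"
  have "has_bochner_integral lborel (\<lambda>t. indicator {-T..T} t *\<^sub>R ?u X t) (?F T - ?F (-T))"
    by (rule has_bochner_integral_FTC_Icc) (auto simp: T_def intro: has_vector_derivative_at_within F cont)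
  moreover have "(\<lambda>t. indicator {-T..T} t *\<^sub>R ?u X t) = (\<lambda>t. ?u X t)"
    using uX0 by (auto simp: fun_eq_iff indicator_def T_def)
  moreover have "?F T = 0" "?F (-T) = 0" by (rule F0, simp add: T_def)+
  ultimately have "has_bochner_integral lborel (\<lambda>t. v t (X 0 t)) 0" by (simp add: vX)
  then show "has_bochner_integral lborel
      (\<lambda>t. v t (\<lambda>x. partial_derivs [(0, 1), (0, 1)] \<phi> (x, t)
                        - of_real (c\<^sup>2) * partial_derivs [(1, 0), (1, 0)] \<phi> (x, t)
                        - of_real (k\<^sup>2 / 4) * \<phi> (x, t))) 0"
    by (simp only: X0[abs_def])
qed

text \<open>Both kernels vanish at t = 0 through their powers of t, and the half translates merge
  into the identity. So W(0) = 0 and V(0) is the identity, which yields both initial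
  conditions.\<close>

lemma wave_op_initial: "wave_op c a E n 0 = (\<lambda>x. 0)" "wave_op_t c a E n 0 = E n 0"
  by (simp_all add: fun_eq_iff wave_op_def wave_op_t_def average_def wave_kernel_def wave_kernel_t_def
      scaleR_left_distrib[symmetric])

theorem theorem1p2:
  fixes k c :: real
    and f g :: "(real \<Rightarrow> complex) \<Rightarrow> complex"
    and v :: "real \<Rightarrow> (real \<Rightarrow> complex) \<Rightarrow> complex"
  assumes "k > 0" and "c > 0"
    and "distribution f" and "distribution g"
    and "\<And>t \<phi>. \<phi> \<in> test_functions \<Longrightarrow>
           v t \<phi> = f (convolution (psi_t k c t) \<phi>)
                  + (g (convolution (psi k c t) \<phi>)
                     + of_real (k / 2) * f (convolution (psi k c t) \<phi>))"
  shows "\<exists>v\<^sub>t. C1_dist v v\<^sub>t \<and> weak_solution k c v \<and>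
           dist_eq (v 0) f \<and>
           dist_eq (v\<^sub>t 0) (\<lambda>\<phi>. g \<phi> + of_real (k / 2) * f \<phi>)"
proof -
  define h where "h \<phi> = g \<phi> + of_real (k / 2) * f \<phi>" for \<phi>
  have h: "distribution h"
    by (rule distribution_lincombI[OF assms(4,3), of _ 1 "of_real (k / 2)"]) (simp add: h_def)
  have v: "v t \<phi> = wave_solution c (k / 4) f h (const_curve \<phi>) t" if "\<phi> \<in> test_functions" for t \<phi>
    using assms(5)[OF that, of t] convolution_psi[OF that \<open>c > 0\<close>, of k t] convolution_psi_t[OF that \<open>c > 0\<close>, of k t]
    by (simp add: wave_solution_def h_def)
  have "dist_eq (v 0) f"
    by (simp add: dist_eq_def v wave_solution_def wave_op_initial distribution_zero[OF h])
      (simp add: const_curve_def)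
  moreover have "dist_eq (\<lambda>\<phi>. wave_solution_t c (k / 4) f h (const_curve \<phi>) 0) h"
    by (simp add: dist_eq_def wave_solution_t_def wave_op_initial distribution_zero[OF assms(3)])
      (simp add: const_curve_def)
  moreover have "C1_dist v (\<lambda>t \<phi>. wave_solution_t c (k / 4) f h (const_curve \<phi>) t)"
    by (rule C1_dist_wave_solution[OF assms(3) h]) (rule v)
  moreover have "weak_solution k c v"
    by (rule weak_solution_wave_solution[OF assms(3) h]) (rule v)
  ultimately show ?thesis unfolding h_def by blast
qed

end
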